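(* For every $\epsilon\in\overline{\mathcal E^*}$, the function $\delta^*$ is not differentiable at the point $\sum\epsilon\widetilde Q\in(0,1)$.
   Context: Coefficient functions. A coefficient function is a sequence $\mu=(\mu_1,\mu_2,\dots)$ of non-negative integers; it has finite support if only finitely many $\mu_k$ are nonzero. $0$ is the zero coefficient function; for $i\ge1$, $\beta^i$ has $\beta^i_i=1$ and $\beta^i_k=0$ for $k\ne i$. Sums are entrywise. For a real sequence $G$, $\sum\mu G:=\sum_{k\ge1}\mu_kG_k$. For $n\ge1$: $\mathrm{rev}_n(\mu)=(\mu_n,\mu_{n-1},\dots,\mu_1,0,0,\dots)$. For finite-support $\mu\ne\mu'$, $\mu<_a\mu'$ means $\mu_k<\mu'_k$ for the largest $k$ with $\mu_k\ne\mu'_k$; for arbitrary $\epsilon\ne\epsilon'$, $\epsilon<_d\epsilon'$ means $\epsilon_k<\epsilon'_k$ for the smallest $k$ with $\epsilon_k\ne\epsilon'_k$. Collections for positive integers. For a list $L=(e_1,\dots,e_N)$ of non-negative integers with $N\ge2$, $e_1\ne0$, let $\beta^*$ be the coefficient function with $\beta^*_k=e_j$ whenever $k\equiv j\pmod N$, $1\le j\le N$; for $n\ge2$ let $\theta^n=\mathrm{rev}_{n-1}(\beta^* )$ (the maximal $L$-block at index $n-1$, support interval $[1,n-1]$). A proper $L$-block at index $n-1$ ($n\ge2$) is a coefficient function $\zeta$ such that for some $k\in[1,n-1]$: $\zeta_j=\theta^n_j$ for $j>k$, $\zeta_k<\theta^n_k$, $\zeta_j=0$ for $j<k$; its support interval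 is $[k,n-1]$. The periodic Zeckendorf collection for positive integers determined by $L$ is the set of all finite sums (including $0$) of $L$-blocks with pairwise disjoint support intervals. The polynomial $x^N-\sum_{k=1}^{N-1}e_kx^{N-k}-(1+e_N)$ has a unique positive zero, which is $>1$. Collections for $(0,1)$. For such $L$ and $n\ge1$, the maximal $L^*$-block at index $n$ is $\bar\beta^n$ with $\bar\beta^n_k=0$ for $k<n$ and $\bar\beta^n_k=e_j$ for $k\ge n$, where $1\le j\le N$, $k-n+1\equiv j\pmod N$. A proper $L^*$-block at index $n$ is a coefficient function $\zeta$ such that for some $k\ge n$: $\zeta_j=\bar\beta^n_j$ for $j<k$, $\zeta_k<\bar\beta^n_k$, $\zeta_j=0$ for $j>k$; its support interval is $[n,k]$. The periodic Zeckendorf collection for $(0,1)$ determined by $L$ is the set of nonzero coefficient functions that are finite or infinite sums of proper $L^*$-blocks with pairwise disjoint support intervals. Standing setup. $L=(e_1,\dots,e_N)$ and $\widetilde L=(\tilde e_1,\dots,\tilde e_M)$ are two such lists whose collections for positive integers $\mathcal E,\widetilde{\mathcal E}$ satisfy $\mathcal E\subsetneq\widetilde{\mathcal E}$; $\phi,\widetilde\phi$ are the positive zeros of their polynomials (one has $1<\phi<\widetilde\phi$); $\gamma=\log_{\widetilde\phi}\phi$; $\omega=1/\phi$, $\widetilde\omega=1/\widetilde\phi$, $Q_n=\omega^n$, $\widetilde Q_n=\widetilde\omega^n$. $\mathcal E^*,\widetilde{\mathcal E}^*$ are the collections for $(0,1)$ determined by $L,\widetilde L$, and $\bar\beta^n$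 the maximal $L^*$-blocks. The map $\epsilon\mapsto\sum\epsilon\widetilde Q$ is a bijection $\widetilde{\mathcal E}^*\to(0,1)$, strictly increasing for $<_d$. For nonzero finite-support $\mu$: $\check\mu$ is the $<_a$-largest element of $\mathcal E$ that is $<_a\mu$, and $\bar\mu$ is the $<_a$-smallest element of $\mathcal E$ that is $>_a\check\mu$. For $\epsilon\in\widetilde{\mathcal E}^*$: if $\epsilon=\bar\beta^1$ or $\bar\beta^1<_d\epsilon$, set $\overline{\mathrm{rev}}(\epsilon)=\bar\beta^1$; otherwise $\overline{\mathrm{rev}}(\epsilon)=\lim_{n\to\infty}\mathrm{rev}_n\big(\overline{\mathrm{rev}_n(\epsilon)}\big)$ (entrywise limit, which exists). Define $\delta_1^*:[\widetilde\omega,1)\to\mathbb R$ by $\delta_1^*(\sum\epsilon\widetilde Q)=\sum\overline{\mathrm{rev}}(\epsilon)Q\,/\,(\sum\epsilon\widetilde Q)^\gamma$ for $\epsilon\in\widetilde{\mathcal E}^*$, and $\delta^*:(0,1)\to\mathbb R$ by $\delta^*(y)=\delta_1^*(y/\widetilde\omega^{n-1})$ where $n\ge1$ satisfies $\widetilde\omega^n\le y<\widetilde\omega^{n-1}$. $\overline{\mathcal E^*}$ is the set of $\epsilon\in\widetilde{\mathcal E}^*$ such that $\epsilon\in\mathcal E^*$ or $\epsilon=\xi+\bar\beta^{b+1}$ for an integer $b\ge0$ and a finite sum $\xi$ of proper $L^*$-blocks with pairwise disjoint support intervals whose union is $[1,b]$ ($\xi=0$ if $b=0$). *)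

theory Defs
  imports Complex_Main "HOL-Library.Disjoint_Sets"
begin

text \<open>Coefficient functions are indexed from 1; they are represented by functions
  \<open>nat \<Rightarrow> nat\<close> whose value at the unused index 0 is 0.\<close>

type_synonym coeff_fun = "nat \<Rightarrow> nat"

definition coeff_sum :: "coeff_fun \<Rightarrow> (nat \<Rightarrow> real) \<Rightarrow> real" where
  "coeff_sum \<mu> G = (\<Sum>k. real (\<mu> (Suc k)) * G (Suc k))"

definition rev_coeff :: "nat \<Rightarrow> coeff_fun \<Rightarrow> coeff_fun" where
  "rev_coeff n \<mu> = (\<lambda>k. if 1 \<le> k \<and> k \<le> n then \<mu> (n + 1 - k) else 0)"

text \<open>The ascending order is only meant for coefficient functions of finite support.\<close>

definition less_asc :: "coeff_fun \<Rightarrow> coeff_fun \<Rightarrow> bool" where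
  "less_asc \<mu> \<mu>' \<longleftrightarrow> (\<exists>k. \<mu> k < \<mu>' k \<and> (\<forall>j>k. \<mu> j = \<mu>' j))"

definition less_desc :: "coeff_fun \<Rightarrow> coeff_fun \<Rightarrow> bool" where
  "less_desc \<epsilon> \<epsilon>' \<longleftrightarrow> (\<exists>k. \<epsilon> k < \<epsilon>' k \<and> (\<forall>j<k. \<epsilon> j = \<epsilon>' j))"

text \<open>The list \<open>(e\<^sub>1, \<dots>, e\<^sub>N)\<close> is \<open>L\<close>, so that \<open>e\<^sub>j\<close> is \<open>L ! (j - 1)\<close>.\<close>

definition zeck_list :: "nat list \<Rightarrow> bool" where
  "zeck_list L \<longleftrightarrow> 2 \<le> length L \<and> L ! 0 \<noteq> 0"

definition zeck_root :: "nat list \<Rightarrow> real" where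
  "zeck_root L = (THE x. 0 < x \<and>
     x ^ length L - (\<Sum>k = 1..length L - 1. real (L ! (k - 1)) * x ^ (length L - k))
       - (1 + real (L ! (length L - 1))) = 0)"

definition beta_star :: "nat list \<Rightarrow> coeff_fun" where
  "beta_star L k = (if k = 0 then 0 else L ! ((k - 1) mod length L))"

definition max_block :: "nat list \<Rightarrow> nat \<Rightarrow> coeff_fun" where
  "max_block L n = rev_coeff (n - 1) (beta_star L)"

text \<open>In the following predicates, the two numerical arguments after \<open>\<zeta>\<close> are the end points of
  the support interval. The zero function is a block for many support intervals, so the
  interval has to be recorded along with the block.\<close>

definition proper_block :: "nat list \<Rightarrow> coeff_fun \<Rightarrow> nat \<Rightarrow> nat \<Rightarrow> bool" where
  "proper_block L \<zeta> a b \<longleftrightarrow> (\<exists>n\<ge>2. b = n - 1 \<and> 1 \<le> a \<and> a \<le> n - 1 \<and>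
     (\<forall>j>a. \<zeta> j = max_block L n j) \<and> \<zeta> a < max_block L n a \<and> (\<forall>j<a. \<zeta> j = 0))"

definition zeck_block :: "nat list \<Rightarrow> coeff_fun \<Rightarrow> nat \<Rightarrow> nat \<Rightarrow> bool" where
  "zeck_block L \<zeta> a b \<longleftrightarrow>
     proper_block L \<zeta> a b \<or> (\<exists>n\<ge>2. a = 1 \<and> b = n - 1 \<and> \<zeta> = max_block L n)"

definition disjoint_supports :: "(coeff_fun \<times> nat \<times> nat) set \<Rightarrow> bool" where
  "disjoint_supports S \<longleftrightarrow> disjoint_family_on (\<lambda>(\<zeta>, a, b). {a..b}) S"

text \<open>Entrywise sum of a possibly infinite set of blocks. If the support intervals are pairwise
  disjoint, at most one block contributes to each entry.\<close>

definition block_sum :: "(coeff_fun \<times> nat \<times> nat) set \<Rightarrow> coeff_fun" where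
  "block_sum S = (\<lambda>k. \<Sum>(\<zeta>, a, b) \<in> {(\<zeta>, a, b) \<in> S. k \<in> {a..b}}. \<zeta> k)"

definition zeck_coll :: "nat list \<Rightarrow> coeff_fun set" where
  "zeck_coll L = {block_sum S | S.
     finite S \<and> (\<forall>(\<zeta>, a, b) \<in> S. zeck_block L \<zeta> a b) \<and> disjoint_supports S}"

definition star_max_block :: "nat list \<Rightarrow> nat \<Rightarrow> coeff_fun" where
  "star_max_block L n = (\<lambda>k. if k < n then 0 else L ! ((k - n) mod length L))"

definition proper_star_block :: "nat list \<Rightarrow> coeff_fun \<Rightarrow> nat \<Rightarrow> nat \<Rightarrow> bool" where
  "proper_star_block L \<zeta> n k \<longleftrightarrow> 1 \<le> n \<and> n \<le> k \<and>
     (\<forall>j<k. \<zeta> j = star_max_block L n j) \<and> \<zeta> k < star_max_block L n k \<and> (\<forall>j>k. \<zeta> j = 0)"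

definition zeck_star_coll :: "nat list \<Rightarrow> coeff_fun set" where
  "zeck_star_coll L = {block_sum S | S.
     (\<forall>(\<zeta>, n, k) \<in> S. proper_star_block L \<zeta> n k) \<and> disjoint_supports S} - {\<lambda>_. 0}"

definition zeck_star_closure :: "nat list \<Rightarrow> nat list \<Rightarrow> coeff_fun set" where
  "zeck_star_closure L Lt = {\<epsilon> \<in> zeck_star_coll Lt. \<epsilon> \<in> zeck_star_coll L \<or>
     (\<exists>b S. finite S \<and> (\<forall>(\<zeta>, n, k) \<in> S. proper_star_block L \<zeta> n k) \<and> disjoint_supports S \<and>
        (\<Union>(\<zeta>, n, k) \<in> S. {n..k}) = {1..b} \<and>
        \<epsilon> = (\<lambda>j. block_sum S j + star_max_block L (b + 1) j))}"

definition zeck_check :: "nat list \<Rightarrow> coeff_fun \<Rightarrow> coeff_fun" where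
  "zeck_check L \<mu> = (THE \<nu>. \<nu> \<in> zeck_coll L \<and> less_asc \<nu> \<mu> \<and>
     (\<forall>\<nu>' \<in> zeck_coll L. less_asc \<nu>' \<mu> \<longrightarrow> \<nu>' = \<nu> \<or> less_asc \<nu>' \<nu>))"

definition zeck_bar :: "nat list \<Rightarrow> coeff_fun \<Rightarrow> coeff_fun" where
  "zeck_bar L \<mu> = (THE \<nu>. \<nu> \<in> zeck_coll L \<and> less_asc (zeck_check L \<mu>) \<nu> \<and>
     (\<forall>\<nu>' \<in> zeck_coll L. less_asc (zeck_check L \<mu>) \<nu>' \<longrightarrow> \<nu>' = \<nu> \<or> less_asc \<nu> \<nu>'))"

text \<open>For the finitely many \<open>n\<close> with \<open>rev_coeff n \<epsilon> = 0\<close> the value of \<open>zeck_bar\<close> is unspecified,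
  which does not affect the limit.\<close>

definition rev_bar :: "nat list \<Rightarrow> coeff_fun \<Rightarrow> coeff_fun" where
  "rev_bar L \<epsilon> =
     (if \<epsilon> = star_max_block L 1 \<or> less_desc (star_max_block L 1) \<epsilon> then star_max_block L 1
      else (\<lambda>k. lim (\<lambda>n. rev_coeff n (zeck_bar L (rev_coeff n \<epsilon>)) k)))"

definition zeck_Q :: "nat list \<Rightarrow> nat \<Rightarrow> real" where
  "zeck_Q L n = (1 / zeck_root L) ^ n"

definition delta1_star :: "nat list \<Rightarrow> nat list \<Rightarrow> real \<Rightarrow> real" where
  "delta1_star L Lt y =
     (let \<epsilon> = (THE \<epsilon>. \<epsilon> \<in> zeck_star_coll Lt \<and> coeff_sum \<epsilon> (zeck_Q Lt) = y)
      in coeff_sum (rev_bar L \<epsilon>) (zeck_Q L) / y powr log (zeck_root Lt) (zeck_root L))"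

definition delta_star :: "nat list \<Rightarrow> nat list \<Rightarrow> real \<Rightarrow> real" where
  "delta_star L Lt y =
     (let n = (THE n. 1 \<le> n \<and> zeck_Q Lt n \<le> y \<and> y < zeck_Q Lt (n - 1))
      in delta1_star L Lt (y / zeck_Q Lt (n - 1)))"

end

theory Submission
  imports Defs
begin

text \<open>
  Read from the most significant digit, a coefficient function is accepted or rejected by an
  automaton whose state is the length of the prefix of \<open>\<beta>\<^sup>*\<close> matched by the current block: a smaller
  digit closes the block, an equal one extends it, a larger one is forbidden. Up to reversal, the
  collection for positive integers consists of the accepted finite words; the collection for
  \<open>(0,1)\<close> consists of the nonzero accepted infinite words in which infinitely many blocks are closed.
  On a word \<open>\<epsilon>\<close> accepted for \<open>L\<close> the operation \<open>rev_bar\<close> is the identity, so there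
  \<open>\<delta>\<^sup>*(y) y\<^sup>\<gamma> = \<Sum>\<epsilon>Q\<close> for \<open>y = \<Sum>\<epsilon>Qt\<close>, where \<open>Qt\<close> is the sequence of negative powers of the zero \<open>\<phi>t\<close>
  belonging to \<open>Lt\<close>. If \<open>\<epsilon>\<close> has infinite support, we approach \<open>y\<close> by the truncations of \<open>\<epsilon>\<close>;
  otherwise by putting a digit 1 at a position \<open>n\<close> far to the right. Changing only digits from
  position \<open>n\<close> on makes the difference quotient of \<open>\<delta>\<^sup>*(y) y\<^sup>\<gamma>\<close> at least \<open>(\<phi>t/\<phi>)\<^sup>n\<close>, which is unbounded
  because \<open>\<phi> < \<phi>t\<close>.
\<close>

section \<open>The block automaton\<close>

text \<open>The state of the automaton after \<open>k\<close> digits. Every unequal digit resets it,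
  larger ones included; only \<open>admissible\<close> tells a closed block from a forbidden
  digit.\<close>

primrec match_len :: "coeff_fun \<Rightarrow> coeff_fun \<Rightarrow> nat \<Rightarrow> nat" where
  "match_len \<beta> w 0 = 0"
| "match_len \<beta> w (Suc k) =
     (if w (Suc k) = \<beta> (Suc (match_len \<beta> w k)) then Suc (match_len \<beta> w k) else 0)"

definition admissible :: "coeff_fun \<Rightarrow> nat \<Rightarrow> coeff_fun \<Rightarrow> bool" where
  "admissible \<beta> n w \<longleftrightarrow> (\<forall>k<n. w (Suc k) \<le> \<beta> (Suc (match_len \<beta> w k)))"

lemma match_len_cong:
  "(\<And>j. 1 \<le> j \<Longrightarrow> j \<le> k \<Longrightarrow> w j = w' j) \<Longrightarrow> match_len \<beta> w k = match_len \<beta> w' k"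
  by (induction k) simp_all

lemma admissible_cong:
  assumes "\<And>j. 1 \<le> j \<Longrightarrow> j \<le> n \<Longrightarrow> w j = w' j"
  shows "admissible \<beta> n w \<longleftrightarrow> admissible \<beta> n w'"
proof -
  have "match_len \<beta> w k = match_len \<beta> w' k" if "k < n" for k
    using that by (intro match_len_cong assms) auto
  moreover have "w (Suc k) = w' (Suc k)" if "k < n" for k
    using that by (intro assms) auto
  ultimately show ?thesis unfolding admissible_def by auto
qed

lemma admissible_mono: "admissible \<beta> n w \<Longrightarrow> m \<le> n \<Longrightarrow> admissible \<beta> m w"
  by (auto simp: admissible_def)

lemma admissible_zero_tail:
  assumes "admissible \<beta> n w" "\<And>j. n < j \<Longrightarrow> w j = 0"
  shows "admissible \<beta> m w"
  unfolding admissible_def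
proof (intro allI impI)
  fix k show "w (Suc k) \<le> \<beta> (Suc (match_len \<beta> w k))"
    using assms by (cases "k < n") (auto simp: admissible_def)
qed

lemma match_len_le: "match_len \<beta> w k \<le> k"
  by (induction k) auto

lemma match_len_add_le: "match_len \<beta> w (k + i) \<le> match_len \<beta> w k + i"
  by (induction i) auto

lemma match_len_run:
  "(\<And>j. k < j \<Longrightarrow> j \<le> k + i \<Longrightarrow> match_len \<beta> w j \<noteq> 0) \<Longrightarrow> match_len \<beta> w (k + i) = match_len \<beta> w k + i"
proof (induction i)
  case (Suc i)
  then have "match_len \<beta> w (k + i) = match_len \<beta> w k + i" by simp
  moreover have "match_len \<beta> w (Suc (k + i)) \<noteq> 0" using Suc.prems[of "Suc (k + i)"] by simp
  ultimately show ?case by (simp split: if_splits)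
qed simp

text \<open>The current match begins right after position \<open>k - match_len \<beta> w k\<close>,
  so this offset converts a position of \<open>w\<close> into a position of
  \<open>\<beta>\<close>.\<close>

lemma match_len_digits:
  "k - match_len \<beta> w k < i \<Longrightarrow> i \<le> k \<Longrightarrow> w i = \<beta> (i - (k - match_len \<beta> w k))"
proof (induction k)
  case (Suc k)
  have le: "match_len \<beta> w k \<le> k" by (rule match_len_le)
  show ?case
  proof (cases "w (Suc k) = \<beta> (Suc (match_len \<beta> w k))")
    case True
    show ?thesis
    proof (cases "i = Suc k")
      case True
      with le \<open>w (Suc k) = _\<close> show ?thesis by (simp add: Suc_diff_le)
    next
      case False
      with Suc True show ?thesis by simp
    qed
  next
    case False
    with Suc.prems show ?thesis by simp
  qed
qed simp

text \<open>A leading 0 never equals \<open>\<beta> 1 > 0\<close>, so the automaton is still in its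
  initial state 0 when the zeros have been read.\<close>

lemma match_len_shift:
  assumes "\<And>j. 1 \<le> j \<Longrightarrow> j \<le> d \<Longrightarrow> w j = 0" "\<beta> 1 > 0"
  shows "match_len \<beta> w (k + d) = match_len \<beta> (\<lambda>j. w (j + d)) k"
proof (induction k)
  case 0
  have "match_len \<beta> w j = 0" if "j \<le> d" for j
    using that assms by (induction j) auto
  then show ?case by simp
qed simp

lemma admissible_shift:
  assumes "\<And>j. 1 \<le> j \<Longrightarrow> j \<le> d \<Longrightarrow> w j = 0" "\<beta> 1 > 0" "admissible \<beta> (n + d) w"
  shows "admissible \<beta> n (\<lambda>j. w (j + d))"
  unfolding admissible_def
proof (intro allI impI)
  fix k assume "k < n"
  then have "w (Suc (k + d)) \<le> \<beta> (Suc (match_len \<beta> w (k + d)))"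
    using assms(3) by (simp add: admissible_def)
  then show "w (Suc k + d) \<le> \<beta> (Suc (match_len \<beta> (\<lambda>j. w (j + d)) k))"
    using match_len_shift[of d w \<beta> k, OF assms(1,2)] by simp
qed

text \<open>The position \<open>Q t\<close> may exceed \<open>n\<close>: this is how a final maximal block is represented.\<close>

lemma admissible_blocks:
  fixes P Q :: "'t \<Rightarrow> nat"
  assumes le: "\<And>t. t \<in> S \<Longrightarrow> 1 \<le> P t \<and> P t \<le> Q t"
    and inner: "\<And>t j. t \<in> S \<Longrightarrow> P t \<le> j \<Longrightarrow> j < Q t \<Longrightarrow> j \<le> n \<Longrightarrow> w j = \<beta> (Suc (j - P t))"
    and last: "\<And>t. t \<in> S \<Longrightarrow> Q t \<le> n \<Longrightarrow> w (Q t) < \<beta> (Suc (Q t - P t))"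
    and disj: "\<And>t t' j. t \<in> S \<Longrightarrow> t' \<in> S \<Longrightarrow> P t \<le> j \<Longrightarrow> j \<le> Q t \<Longrightarrow> P t' \<le> j \<Longrightarrow> j \<le> Q t'
                \<Longrightarrow> t = t'"
    and zero: "\<And>j. 1 \<le> j \<Longrightarrow> j \<le> n \<Longrightarrow> (\<And>t. t \<in> S \<Longrightarrow> \<not> (P t \<le> j \<and> j \<le> Q t)) \<Longrightarrow> w j = 0"
    and pos: "\<beta> 1 > 0"
  shows "admissible \<beta> n w"
    and "k \<le> n \<Longrightarrow> (\<And>t. t \<in> S \<Longrightarrow> \<not> (P t \<le> k \<and> k < Q t)) \<Longrightarrow> match_len \<beta> w k = 0"
proof -
  \<comment> \<open>Inside a block the state counts the digits of the block read so far, elsewhere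
    it is 0; knowing the state then gives the bound on the next digit.\<close>
  have state: "(\<forall>t\<in>S. P t \<le> k \<and> k < Q t \<longrightarrow> match_len \<beta> w k = Suc k - P t) \<and>
      ((\<forall>t\<in>S. \<not> (P t \<le> k \<and> k < Q t)) \<longrightarrow> match_len \<beta> w k = 0) \<and>
      (k < n \<longrightarrow> w (Suc k) \<le> \<beta> (Suc (match_len \<beta> w k)))" if "k \<le> n" for k
    using that
  proof (induction k rule: less_induct)
    case (less k)
    \<comment> \<open>Used at the predecessor of \<open>k\<close> to find the state at
      \<open>k\<close>, and at \<open>k\<close> itself to bound the next digit. When a block starts
      at \<open>Suc k'\<close>, disjointness keeps every other block from running past
      \<open>k'\<close>, so the state there is 0.\<close>
    have digit: "(\<exists>t\<in>S. P t \<le> Suc k' \<and> Suc k' \<le> Q t \<and> match_len \<beta> w k' = Suc k' - P t) \<or>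
       ((\<forall>t\<in>S. \<not> (P t \<le> Suc k' \<and> Suc k' \<le> Q t)) \<and> match_len \<beta> w k' = 0 \<and> w (Suc k') = 0)"
      if st1: "\<And>t. t \<in> S \<Longrightarrow> P t \<le> k' \<Longrightarrow> k' < Q t \<Longrightarrow> match_len \<beta> w k' = Suc k' - P t"
        and st0: "(\<And>t. t \<in> S \<Longrightarrow> \<not> (P t \<le> k' \<and> k' < Q t)) \<Longrightarrow> match_len \<beta> w k' = 0"
        and "k' < n" for k'
    proof (cases "\<exists>t\<in>S. P t \<le> Suc k' \<and> Suc k' \<le> Q t")
      case True
      then obtain t where t: "t \<in> S" "P t \<le> Suc k'" "Suc k' \<le> Q t" by blast
      have "match_len \<beta> w k' = Suc k' - P t"
      proof (cases "P t = Suc k'")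
        case True
        have "\<not> (P t' \<le> k' \<and> k' < Q t')" if "t' \<in> S" for t'
        proof
          assume "P t' \<le> k' \<and> k' < Q t'"
          then have "t = t'" using disj[OF t(1) that t(2,3)] by auto
          then show False using True \<open>P t' \<le> k' \<and> _\<close> by auto
        qed
        then show ?thesis using st0 True by auto
      next
        case False
        then show ?thesis using st1 t by auto
      qed
      then show ?thesis using t by blast
    next
      case False
      then have "w (Suc k') = 0" using zero[of "Suc k'"] \<open>k' < n\<close> by auto
      moreover have "match_len \<beta> w k' = 0"
        by (rule st0) (use False in force)
      ultimately show ?thesis using False by blast
    qed
    have A: "(\<forall>t\<in>S. P t \<le> k \<and> k < Q t \<longrightarrow> match_len \<beta> w k = Suc k - P t) \<and>
      ((\<forall>t\<in>S. \<not> (P t \<le> k \<and> k < Q t)) \<longrightarrow> match_len \<beta> w k = 0)"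
    proof (cases k)
      case 0
      then show ?thesis using le by force
    next
      case (Suc k')
      then have IH: "\<And>t. t \<in> S \<Longrightarrow> P t \<le> k' \<Longrightarrow> k' < Q t \<Longrightarrow> match_len \<beta> w k' = Suc k' - P t"
        "(\<And>t. t \<in> S \<Longrightarrow> \<not> (P t \<le> k' \<and> k' < Q t)) \<Longrightarrow> match_len \<beta> w k' = 0" "k' < n"
        using less.IH[of k'] less.prems by auto
      from digit[OF IH] show ?thesis
      proof
        assume "\<exists>t\<in>S. P t \<le> Suc k' \<and> Suc k' \<le> Q t \<and> match_len \<beta> w k' = Suc k' - P t"
        then obtain t where t: "t \<in> S" "P t \<le> Suc k'" "Suc k' \<le> Q t"
          "match_len \<beta> w k' = Suc k' - P t" by blast
        have only: "t' = t" if "t' \<in> S" "P t' \<le> k" "k < Q t'" for t'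
          using disj[of t' t k] that t Suc by auto
        show ?thesis
        proof (cases "k < Q t")
          case True
          then have "w k = \<beta> (Suc (k - P t))" using inner t Suc less.prems by auto
          then have "match_len \<beta> w k = Suc k - P t" using t Suc by (simp add: Suc_diff_le)
          then show ?thesis using only t True Suc by blast
        next
          case False
          then have "k = Q t" using t Suc by auto
          then have "w k < \<beta> (Suc (k - P t))" using last[OF t(1)] less.prems by auto
          then have "match_len \<beta> w k = 0" using t Suc by simp
          then show ?thesis using only False by blast
        qed
      next
        assume "(\<forall>t\<in>S. \<not> (P t \<le> Suc k' \<and> Suc k' \<le> Q t)) \<and> match_len \<beta> w k' = 0 \<and> w (Suc k') = 0"
        then show ?thesis using pos Suc by force
      qed
    qed
    have B: "w (Suc k) \<le> \<beta> (Suc (match_len \<beta> w k))" if "k < n"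
    proof -
      have "(\<exists>t\<in>S. P t \<le> Suc k \<and> Suc k \<le> Q t \<and> match_len \<beta> w k = Suc k - P t) \<or>
       ((\<forall>t\<in>S. \<not> (P t \<le> Suc k \<and> Suc k \<le> Q t)) \<and> match_len \<beta> w k = 0 \<and> w (Suc k) = 0)"
        by (rule digit) (use A that in auto)
      then show ?thesis
      proof
        assume "\<exists>t\<in>S. P t \<le> Suc k \<and> Suc k \<le> Q t \<and> match_len \<beta> w k = Suc k - P t"
        then obtain t where t: "t \<in> S" "P t \<le> Suc k" "Suc k \<le> Q t"
          "match_len \<beta> w k = Suc k - P t" by blast
        show ?thesis
        proof (cases "Suc k < Q t")
          case True
          then show ?thesis using inner[OF t(1,2)] that t(4) by simp
        next
          case False
          then have "Q t = Suc k" using t by auto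
          then show ?thesis using last[OF t(1)] that t(4) by simp
        qed
      qed simp
    qed
    from A B show ?case by blast
  qed
  from state show "admissible \<beta> n w" by (auto simp: admissible_def)
  show "match_len \<beta> w k = 0" if "k \<le> n" "\<And>t. t \<in> S \<Longrightarrow> \<not> (P t \<le> k \<and> k < Q t)"
    using state[OF that(1)] that(2) by simp
qed

section \<open>Sums over blocks with disjoint supports\<close>

lemma disjoint_supports_unique:
  assumes "disjoint_supports S" "(\<zeta>, a, b) \<in> S" "(\<zeta>', a', b') \<in> S"
    "a \<le> k" "k \<le> b" "a' \<le> k" "k \<le> b'"
  shows "(\<zeta>, a, b) = (\<zeta>', a', b')"
proof (rule ccontr)
  assume "(\<zeta>, a, b) \<noteq> (\<zeta>', a', b')"
  with assms(1-3) have "{a..b} \<inter> {a'..b'} = {}"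
    unfolding disjoint_supports_def disjoint_family_on_def by blast
  with assms(4-7) show False by (metis IntI atLeastAtMost_iff empty_iff)
qed

lemma block_sum_eq:
  assumes "disjoint_supports S" "(\<zeta>, a, b) \<in> S" "a \<le> k" "k \<le> b"
  shows "block_sum S k = \<zeta> k"
proof -
  have "{(\<zeta>, a, b) \<in> S. k \<in> {a..b}} = {(\<zeta>, a, b)}"
  proof (intro equalityI subsetI)
    fix t assume "t \<in> {(\<zeta>, a, b) \<in> S. k \<in> {a..b}}"
    then show "t \<in> {(\<zeta>, a, b)}"
      using disjoint_supports_unique[OF assms(1,2) _ assms(3,4)] by (cases t) auto
  qed (use assms in auto)
  then show ?thesis by (simp add: block_sum_def)
qed

lemma block_sum_zero:
  assumes "\<And>\<zeta> a b. (\<zeta>, a, b) \<in> S \<Longrightarrow> \<not> (a \<le> k \<and> k \<le> b)"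
  shows "block_sum S k = 0"
proof -
  have eq: "{(\<zeta>, a, b) \<in> S. k \<in> {a..b}} = {}" using assms by auto
  show ?thesis unfolding block_sum_def eq by simp
qed

lemma beta_star_Suc: "beta_star L (Suc k) = L ! (k mod length L)"
  by (simp add: beta_star_def)

lemma star_max_block_eq:
  "star_max_block L n k = (if k < n then 0 else beta_star L (Suc (k - n)))"
  by (simp add: star_max_block_def beta_star_Suc)

lemma max_block_eq:
  "max_block L n j = (if 1 \<le> j \<and> j < n then beta_star L (n - j) else 0)"
  by (auto simp: max_block_def rev_coeff_def)

lemma beta_star_1_pos: "zeck_list L \<Longrightarrow> 0 < beta_star L 1"
  by (simp add: beta_star_def zeck_list_def)

lemma rev_coeff_rev_coeff: "1 \<le> k \<Longrightarrow> k \<le> n \<Longrightarrow> rev_coeff n (rev_coeff n w) k = w k"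
  by (auto simp: rev_coeff_def)

section \<open>Block decompositions of infinite words\<close>

text \<open>The first position of the block to which position \<open>q\<close> belongs: just before
  digit \<open>q\<close> is read, the state counts the digits of that block already read.\<close>

definition block_start :: "coeff_fun \<Rightarrow> coeff_fun \<Rightarrow> nat \<Rightarrow> nat" where
  "block_start \<beta> w q = q - match_len \<beta> w (q - 1)"

lemma block_start_bounds:
  assumes "1 \<le> q"
  shows "1 \<le> block_start \<beta> w q" "block_start \<beta> w q \<le> q"
  using match_len_le[of \<beta> w "q - 1"] assms by (auto simp: block_start_def)

lemma block_inner_digit:
  assumes "block_start \<beta> w q \<le> j" "j < q"
  shows "w j = \<beta> (Suc (j - block_start \<beta> w q))"
proof -
  have "match_len \<beta> w (q - 1) \<le> q - 1" by (rule match_len_le)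
  then show ?thesis
    using match_len_digits[of "q - 1" \<beta> w j] assms
    by (auto simp: block_start_def Suc_diff_le)
qed

text \<open>Admissibility excludes a larger digit, and the reset at \<open>q\<close> excludes an
  equal one.\<close>

lemma block_last_digit:
  assumes "admissible \<beta> q w" "1 \<le> q" "match_len \<beta> w q = 0"
  shows "w q < \<beta> (Suc (q - block_start \<beta> w q))"
proof -
  have le: "match_len \<beta> w (q - 1) \<le> q - 1" by (rule match_len_le)
  obtain k where k: "q = Suc k" using assms by (cases q) auto
  have "w (Suc k) \<le> \<beta> (Suc (match_len \<beta> w k))" using assms(1) by (simp add: admissible_def k)
  moreover have "w (Suc k) \<noteq> \<beta> (Suc (match_len \<beta> w k))" using assms(3) k by auto
  ultimately show ?thesis using le by (simp add: block_start_def k)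
qed

text \<open>The state grows by at most one per digit, so no match can reach back across an earlier
  reset. This gives the disjointness of the supports below.\<close>

lemma block_start_gt:
  assumes "match_len \<beta> w q = 0" "q < q'"
  shows "q < block_start \<beta> w q'"
  using match_len_add_le[of \<beta> w q "q' - 1 - q"] assms by (auto simp: block_start_def)

lemma block_start_le:
  assumes "1 \<le> k" "k \<le> q" "\<And>j. k \<le> j \<Longrightarrow> j < q \<Longrightarrow> match_len \<beta> w j \<noteq> 0"
  shows "block_start \<beta> w q \<le> k"
  using match_len_run[of "k - 1" "q - k" \<beta> w] assms by (auto simp: block_start_def)

text \<open>The first reset at or after \<open>k\<close> closes the block that covers
  \<open>k\<close>; hence every position followed by a reset lies in some block.\<close>

lemma ex_block_end:
  assumes "1 \<le> k" "k \<le> q" "match_len \<beta> w q = 0"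
  obtains q' where "k \<le> q'" "q' \<le> q" "match_len \<beta> w q' = 0" "block_start \<beta> w q' \<le> k"
proof -
  define q' where "q' = (LEAST j. k \<le> j \<and> match_len \<beta> w j = 0)"
  have q': "k \<le> q' \<and> match_len \<beta> w q' = 0"
    unfolding q'_def by (rule LeastI[of _ q]) (use assms in auto)
  have "q' \<le> q" unfolding q'_def by (rule Least_le) (use assms in auto)
  moreover have "match_len \<beta> w j \<noteq> 0" if "k \<le> j" "j < q'" for j
    using not_less_Least[of j "\<lambda>j. k \<le> j \<and> match_len \<beta> w j = 0"] that by (auto simp: q'_def)
  then have "block_start \<beta> w q' \<le> k" using assms(1) q' by (intro block_start_le) auto
  ultimately show thesis using that q' by blast
qed

lemma proper_star_blockD:
  assumes "proper_star_block L \<zeta> a b"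
  shows "1 \<le> a" "a \<le> b" "\<And>j. a \<le> j \<Longrightarrow> j < b \<Longrightarrow> \<zeta> j = beta_star L (Suc (j - a))"
    "\<zeta> b < beta_star L (Suc (b - a))"
  using assms by (auto simp: proper_star_block_def star_max_block_eq)

text \<open>Here \<open>admissible_blocks\<close> applies with the triples in \<open>S\<close> as
  index set and their recorded end points as \<open>P\<close> and \<open>Q\<close>.\<close>

lemma star_blocks_admissible:
  assumes L: "zeck_list L"
    and S: "\<And>\<zeta> a b. (\<zeta>, a, b) \<in> S \<Longrightarrow> proper_star_block L \<zeta> a b" "disjoint_supports S"
  shows "admissible (beta_star L) n (block_sum S)"
    and "\<exists>q\<ge>k. match_len (beta_star L) (block_sum S) q = 0"
    and "block_sum S 0 = 0"
proof -
  let ?P = "\<lambda>t :: coeff_fun \<times> nat \<times> nat. fst (snd t)" and ?Q = "\<lambda>t :: coeff_fun \<times> nat \<times> nat. snd (snd t)"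
  have 1: "1 \<le> ?P t \<and> ?P t \<le> ?Q t" if "t \<in> S" for t
    using S(1) that by (cases t) (auto simp: proper_star_block_def)
  have 2: "block_sum S j = beta_star L (Suc (j - ?P t))" if "t \<in> S" "?P t \<le> j" "j < ?Q t" for t j
    using block_sum_eq[OF S(2), of "fst t" "?P t" "?Q t" j] proper_star_blockD(3)[OF S(1)[of "fst t" "?P t" "?Q t"]] that
    by simp
  have 3: "block_sum S (?Q t) < beta_star L (Suc (?Q t - ?P t))" if "t \<in> S" for t
    using block_sum_eq[OF S(2), of "fst t" "?P t" "?Q t" "?Q t"] proper_star_blockD(4)[OF S(1)[of "fst t" "?P t" "?Q t"]]
      that 1[OF that]
    by simp
  have 4: "t = t'" if "t \<in> S" "t' \<in> S" "?P t \<le> j" "j \<le> ?Q t" "?P t' \<le> j" "j \<le> ?Q t'" for t t' j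
    using that disjoint_supports_unique[OF S(2)] by (cases t; cases t') auto
  have 5: "block_sum S j = 0" if "\<And>t. t \<in> S \<Longrightarrow> \<not> (?P t \<le> j \<and> j \<le> ?Q t)" for j
    using that by (intro block_sum_zero) force
  note pos = beta_star_1_pos[OF L]
  show "admissible (beta_star L) n (block_sum S)"
    by (rule admissible_blocks(1)[of S ?P ?Q])
      (erule 1, erule (2) 2, erule 3, erule (5) 4, rule 5, blast, rule pos)
  have state0: "match_len (beta_star L) (block_sum S) k = 0"
    if "\<And>t. t \<in> S \<Longrightarrow> \<not> (?P t \<le> k \<and> k < ?Q t)" for k
    by (rule admissible_blocks(2)[of S ?P ?Q k])
      (erule 1, erule (2) 2, erule 3, erule (5) 4, rule 5, blast, rule pos, rule order_refl, erule that)
  show "block_sum S 0 = 0" by (rule 5) (use 1 in force)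
  \<comment> \<open>Inside a block the automaton reaches state 0 at the end of that block; outside
    all blocks it is in state 0 already.\<close>
  show "\<exists>q\<ge>k. match_len (beta_star L) (block_sum S) q = 0"
  proof (cases "\<exists>t\<in>S. ?P t \<le> k \<and> k < ?Q t")
    case True
    then obtain t where t: "t \<in> S" "?P t \<le> k" "k < ?Q t" by blast
    have "match_len (beta_star L) (block_sum S) (?Q t) = 0"
    proof (rule state0)
      fix t' assume t': "t' \<in> S"
      show "\<not> (?P t' \<le> ?Q t \<and> ?Q t < ?Q t')"
        using 4[OF t(1) t', of "?Q t"] t by auto
    qed
    then show ?thesis using t by (intro exI[of _ "?Q t"]) auto
  next
    case False
    then have "match_len (beta_star L) (block_sum S) k = 0" by (intro state0) auto
    then show ?thesis by blast
  qed
qed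

text \<open>For the converse, \<open>w\<close> is cut after each reset. Infinitely many resets make
  these blocks cover every position; a last reset would instead leave a maximal block that is never
  closed.\<close>

lemma zeck_star_coll_iff:
  assumes L: "zeck_list L"
  shows "w \<in> zeck_star_coll L \<longleftrightarrow> w \<noteq> (\<lambda>_. 0) \<and> w 0 = 0 \<and> (\<forall>n. admissible (beta_star L) n w) \<and>
    (\<forall>k. \<exists>q\<ge>k. match_len (beta_star L) w q = 0)"
    (is "?l \<longleftrightarrow> ?r")
proof
  assume ?l
  then obtain S where w: "w = block_sum S" "w \<noteq> (\<lambda>_. 0)"
    and S: "\<forall>(\<zeta>, n, k) \<in> S. proper_star_block L \<zeta> n k" "disjoint_supports S"
    unfolding zeck_star_coll_def by blast
  have S': "\<And>\<zeta> a b. (\<zeta>, a, b) \<in> S \<Longrightarrow> proper_star_block L \<zeta> a b" using S(1) by blast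
  show ?r using star_blocks_admissible[OF L S' S(2)] w by blast
next
  assume r: ?r
  let ?\<beta> = "beta_star L"
  let ?m = "match_len ?\<beta> w" and ?p = "block_start ?\<beta> w"
  define M where "M = {q. 1 \<le> q \<and> ?m q = 0}"
  define Z where "Z q = (\<lambda>j. if ?p q \<le> j \<and> j \<le> q then w j else 0)" for q
  define S where "S = (\<lambda>q. (Z q, ?p q, q)) ` M"
  have blk: "proper_star_block L (Z q) (?p q) q" if "q \<in> M" for q
    using that r block_start_bounds[of q ?\<beta> w] block_inner_digit[of ?\<beta> w q]
      block_last_digit[of ?\<beta> q w]
    by (auto simp: proper_star_block_def star_max_block_eq Z_def M_def)
  have disj: "disjoint_supports S"
    unfolding disjoint_supports_def disjoint_family_on_def
  proof (intro ballI impI)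
    fix t t' assume tt: "t \<in> S" "t' \<in> S" "t \<noteq> t'"
    then obtain q q' where q: "q \<in> M" "q' \<in> M" "q \<noteq> q'" "t = (Z q, ?p q, q)" "t' = (Z q', ?p q', q')"
      unfolding S_def by auto
    show "(case t of (\<zeta>, a, b) \<Rightarrow> {a..b}) \<inter> (case t' of (\<zeta>, a, b) \<Rightarrow> {a..b}) = {}"
      using q block_start_gt[of ?\<beta> w q q'] block_start_gt[of ?\<beta> w q' q]
      by (cases "q < q'") (auto simp: M_def)
  qed
  have "block_sum S = w"
  proof
    fix k
    show "block_sum S k = w k"
    proof (cases "k = 0")
      case True
      have "block_sum S 0 = 0"
      proof (rule block_sum_zero)
        fix \<zeta> a b assume "(\<zeta>, a, b) \<in> S"
        then obtain q where "q \<in> M" "a = ?p q" by (auto simp: S_def)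
        then show "\<not> (a \<le> 0 \<and> 0 \<le> b)" using block_start_bounds(1)[of q ?\<beta> w] by (simp add: M_def)
      qed
      then show ?thesis using True r by simp
    next
      case False
      obtain q where "q \<ge> k" "?m q = 0" using r by blast
      then obtain q' where q': "k \<le> q'" "?m q' = 0" "?p q' \<le> k"
        using ex_block_end[of k q ?\<beta> w] False by auto
      have "(Z q', ?p q', q') \<in> S" using q' False by (auto simp: S_def M_def)
      from block_sum_eq[OF disj this] q' show ?thesis by (simp add: Z_def)
    qed
  qed
  moreover have "\<forall>(\<zeta>, n, k) \<in> S. proper_star_block L \<zeta> n k" using blk by (auto simp: S_def)
  ultimately show ?l using r disj unfolding zeck_star_coll_def by blast
qed

text \<open>A word of the closure outside the collection for \<open>L\<close> ends in an infinite
  maximal block. Its digits equal the bounds set by the automaton, so every prefix remains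
  admissible although resets stop.\<close>

lemma zeck_star_closure_admissible:
  assumes L: "zeck_list L" and w: "w \<in> zeck_star_closure L Lt"
  shows "admissible (beta_star L) n w"
proof (cases "w \<in> zeck_star_coll L")
  case True
  then show ?thesis using zeck_star_coll_iff[OF L] by blast
next
  case False
  then obtain c S where S: "\<forall>(\<zeta>, n, k) \<in> S. proper_star_block L \<zeta> n k" "disjoint_supports S"
    and U: "(\<Union>(\<zeta>, n, k) \<in> S. {n..k}) = {1..c}"
    and weq: "w = (\<lambda>j. block_sum S j + star_max_block L (c + 1) j)"
    using w unfolding zeck_star_closure_def by blast
  let ?P = "\<lambda>t :: coeff_fun \<times> nat \<times> nat. fst (snd t)" and ?Q = "\<lambda>t :: coeff_fun \<times> nat \<times> nat. snd (snd t)"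
  \<comment> \<open>Only \<open>n\<close> digits are tested, so the infinite maximal block may be
    replaced by one whose end \<open>c + n + 1\<close> lies beyond them.\<close>
  define T where "T = insert (star_max_block L (c + 1), c + 1, c + n + 1) S"
  have S': "proper_star_block L \<zeta> a b" "1 \<le> a" "a \<le> b" "b \<le> c" if "(\<zeta>, a, b) \<in> S" for \<zeta> a b
  proof -
    show p: "proper_star_block L \<zeta> a b" using S that by blast
    then show ab: "1 \<le> a" "a \<le> b" by (auto simp: proper_star_block_def)
    have "b \<in> (\<Union>(\<zeta>, n, k) \<in> S. {n..k})" using that ab by force
    then show "b \<le> c" using U by auto
  qed
  have high: "w j = beta_star L (Suc (j - (c + 1)))" if "c < j" for j
  proof -
    have "block_sum S j = 0" using S'(4) that by (intro block_sum_zero) fastforce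
    then show ?thesis using that by (simp add: weq star_max_block_eq)
  qed
  have low: "w j = \<zeta> j" if "(\<zeta>, a, b) \<in> S" "a \<le> j" "j \<le> b" for \<zeta> a b j
    using block_sum_eq[OF S(2) that] S'(4)[OF that(1)] that by (simp add: weq star_max_block_eq)
  show ?thesis
  proof (rule admissible_blocks(1)[of T ?P ?Q])
    show "1 \<le> ?P t \<and> ?P t \<le> ?Q t" if "t \<in> T" for t
      using that S' by (cases t) (auto simp: T_def)
    show "w j = beta_star L (Suc (j - ?P t))" if "t \<in> T" "?P t \<le> j" "j < ?Q t" for t j
    proof (cases "t \<in> S")
      case True
      then show ?thesis
        using that low[of "fst t" "?P t" "?Q t" j] proper_star_blockD(3)[OF S'(1)[of "fst t" "?P t" "?Q t"]] by simp
    next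
      case False
      then show ?thesis using that high by (auto simp: T_def)
    qed
    show "w (?Q t) < beta_star L (Suc (?Q t - ?P t))" if "t \<in> T" "?Q t \<le> n" for t
    proof -
      obtain \<zeta> a b where t: "t = (\<zeta>, a, b)" by (cases t)
      have "(\<zeta>, a, b) \<in> S" using that t by (auto simp: T_def)
      then show ?thesis using low[of \<zeta> a b b] S'[of \<zeta> a b] t
          proper_star_blockD(4)[of L \<zeta> a b] by simp
    qed
    show "t = t'" if "t \<in> T" "t' \<in> T" "?P t \<le> j" "j \<le> ?Q t" "?P t' \<le> j" "j \<le> ?Q t'" for t t' j
    proof -
      obtain \<zeta> a b \<zeta>' a' b' where t: "t = (\<zeta>, a, b)" "t' = (\<zeta>', a', b')" by (cases t, cases t')
      show ?thesis using that disjoint_supports_unique[OF S(2), of \<zeta> a b \<zeta>' a' b' j] S'(4)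
        by (force simp: T_def t)
    qed
    \<comment> \<open>No gap occurs: the blocks in \<open>S\<close> cover \<open>1..c\<close>, and
      the added one covers the rest up to \<open>n\<close>.\<close>
    show "w j = 0" if "1 \<le> j" "j \<le> n" "\<And>t. t \<in> T \<Longrightarrow> \<not> (?P t \<le> j \<and> j \<le> ?Q t)" for j
    proof -
      have "j \<notin> (\<Union>(\<zeta>, n, k) \<in> S. {n..k})" using that(3) by (force simp: T_def)
      then have "c < j" using U that(1) by auto
      then show ?thesis using that(2) that(3)[of "(star_max_block L (c + 1), c + 1, c + n + 1)"]
        by (auto simp: T_def)
    qed
  qed (rule beta_star_1_pos[OF L])
qed

section \<open>Block decompositions of finite words\<close>

lemma proper_block_iff:
  "proper_block L \<zeta> a b \<longleftrightarrow> 1 \<le> a \<and> a \<le> b \<and> (\<forall>j>a. \<zeta> j = max_block L (Suc b) j) \<and>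
     \<zeta> a < max_block L (Suc b) a \<and> (\<forall>j<a. \<zeta> j = 0)"
proof -
  have "2 \<le> n \<and> b = n - 1 \<and> 1 \<le> a \<and> a \<le> n - 1 \<longleftrightarrow> n = Suc b \<and> 1 \<le> a \<and> a \<le> b" for n
    by auto
  then show ?thesis unfolding proper_block_def by metis
qed

lemma zeck_block_iff:
  "zeck_block L \<zeta> a b \<longleftrightarrow> proper_block L \<zeta> a b \<or> (a = 1 \<and> 1 \<le> b \<and> \<zeta> = max_block L (Suc b))"
proof -
  have "2 \<le> n \<and> a = 1 \<and> b = n - 1 \<longleftrightarrow> n = Suc b \<and> a = 1 \<and> 1 \<le> b" for n
    by auto
  then show ?thesis unfolding zeck_block_def by metis
qed

lemma proper_blockD:
  assumes "proper_block L \<zeta> a b"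
  shows "1 \<le> a" "a \<le> b" "\<And>j. a < j \<Longrightarrow> j \<le> b \<Longrightarrow> \<zeta> j = beta_star L (Suc (b - j))"
    "\<zeta> a < beta_star L (Suc (b - a))"
  using assms by (auto simp: proper_block_iff max_block_eq Suc_diff_le)

lemma proper_blockI:
  assumes "1 \<le> a" "a \<le> b" "\<And>j. a < j \<Longrightarrow> j \<le> b \<Longrightarrow> \<zeta> j = beta_star L (Suc (b - j))"
    "\<zeta> a < beta_star L (Suc (b - a))" "\<And>j. j < a \<or> b < j \<Longrightarrow> \<zeta> j = 0"
  shows "proper_block L \<zeta> a b"
  using assms by (auto simp: proper_block_iff max_block_eq Suc_diff_le)

lemma zeck_blockD:
  assumes "zeck_block L \<zeta> a b"
  shows "1 \<le> a" "a \<le> b" "\<And>j. a < j \<Longrightarrow> j \<le> b \<Longrightarrow> \<zeta> j = beta_star L (Suc (b - j))"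
    "\<zeta> a \<le> beta_star L (Suc (b - a))"
    "proper_block L \<zeta> a b \<or> (a = 1 \<and> \<zeta> a = beta_star L (Suc (b - a)))"
  using assms proper_blockD[of L \<zeta> a b]
  by (auto simp: zeck_block_iff max_block_eq Suc_diff_le less_imp_le)

text \<open>Under reversal a block read from \<open>p\<close> to a reset at \<open>q\<close> becomes
  a proper block on the interval from \<open>Suc n - q\<close> to \<open>Suc n - p\<close>, and the
  digits after the last reset become a maximal block at the bottom.\<close>

lemma rev_coeff_in_zeck_coll:
  assumes adm: "admissible (beta_star L) n w"
  shows "rev_coeff n w \<in> zeck_coll L"
proof -
  let ?\<beta> = "beta_star L"
  let ?m = "match_len ?\<beta> w" and ?p = "block_start ?\<beta> w"
  define M where "M = {q. 1 \<le> q \<and> q \<le> n \<and> ?m q = 0}"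
  define Z where "Z q = (\<lambda>j. if Suc n - q \<le> j \<and> j \<le> Suc n - ?p q then w (Suc n - j) else 0)" for q
  \<comment> \<open>A final state \<open>s > 0\<close> means an unfinished match of length
    \<open>s\<close>, placed on \<open>1..s\<close>. For \<open>s = 0\<close> nothing is left over,
    and blocks have nonempty support.\<close>
  define S where "S = (\<lambda>q. (Z q, Suc n - q, Suc n - ?p q)) ` M \<union>
    (if ?m n = 0 then {} else {(max_block L (Suc (?m n)), 1, ?m n)})"
  have M: "1 \<le> ?p q" "?p q \<le> q" "q \<le> n" "\<And>j. ?p q \<le> j \<Longrightarrow> j < q \<Longrightarrow> w j = ?\<beta> (Suc (j - ?p q))"
    "w q < ?\<beta> (Suc (q - ?p q))" "?m n \<le> n - q" if "q \<in> M" for q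
  proof -
    from that have q: "1 \<le> q" "q \<le> n" "?m q = 0" by (auto simp: M_def)
    show "1 \<le> ?p q" "?p q \<le> q" "q \<le> n" using block_start_bounds q by auto
    show "w j = ?\<beta> (Suc (j - ?p q))" if "?p q \<le> j" "j < q" for j
      using that by (rule block_inner_digit)
    show "w q < ?\<beta> (Suc (q - ?p q))"
      using block_last_digit admissible_mono[OF adm q(2)] q by blast
    show "?m n \<le> n - q" using match_len_add_le[of ?\<beta> w q "n - q"] q by simp
  qed
  have blk: "proper_block L (Z q) (Suc n - q) (Suc n - ?p q)" if "q \<in> M" for q
  proof (rule proper_blockI)
    note q = M[OF that]
    show "1 \<le> Suc n - q" "Suc n - q \<le> Suc n - ?p q" using q by auto
    show "Z q j = ?\<beta> (Suc (Suc n - ?p q - j))" if "Suc n - q < j" "j \<le> Suc n - ?p q" for j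
    proof -
      have "?p q \<le> Suc n - j" "Suc n - j < q" using that q by auto
      from q(4)[OF this] show ?thesis using that by (simp add: Z_def add.commute)
    qed
    show "Z q (Suc n - q) < ?\<beta> (Suc (Suc n - ?p q - (Suc n - q)))"
    proof -
      have "Suc n - ?p q - (Suc n - q) = q - ?p q" "Suc n - (Suc n - q) = q" using q by auto
      then show ?thesis using q(5) diff_le_mono2[OF q(2), of "Suc n"] by (simp add: Z_def)
    qed
    show "Z q j = 0" if "j < Suc n - q \<or> Suc n - ?p q < j" for j
      using that by (auto simp: Z_def)
  qed
  have disj: "disjoint_supports S"
    unfolding disjoint_supports_def disjoint_family_on_def
  proof (intro ballI impI)
    fix t t' assume tt: "t \<in> S" "t' \<in> S" "t \<noteq> t'"
    have gt: "q < ?p q'" if "q \<in> M" "q' \<in> M" "q < q'" for q q'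
      using that block_start_gt[of ?\<beta> w q q'] by (auto simp: M_def)
    have MM: "{Suc n - q..Suc n - ?p q} \<inter> {Suc n - q'..Suc n - ?p q'} = {}"
      if "q \<in> M" "q' \<in> M" "q < q'" for q q'
      using gt[OF that] M(1-3)[OF that(1)] M(1-3)[OF that(2)] by auto
    have MT: "{Suc n - q..Suc n - ?p q} \<inter> {1..?m n} = {}" if "q \<in> M" for q
      using M(3,6)[OF that] by auto
    consider q q' where "q \<in> M" "q' \<in> M" "q \<noteq> q'"
        "t = (Z q, Suc n - q, Suc n - ?p q)" "t' = (Z q', Suc n - q', Suc n - ?p q')"
      | q where "q \<in> M" "t = (Z q, Suc n - q, Suc n - ?p q)" "t' = (max_block L (Suc (?m n)), 1, ?m n)"
      | q where "q \<in> M" "t' = (Z q, Suc n - q, Suc n - ?p q)" "t = (max_block L (Suc (?m n)), 1, ?m n)"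
      using tt unfolding S_def by (auto split: if_splits)
    then show "(case t of (\<zeta>, a, b) \<Rightarrow> {a..b}) \<inter> (case t' of (\<zeta>, a, b) \<Rightarrow> {a..b}) = {}"
    proof cases
      case 1
      then show ?thesis using MM[of q q'] MM[of q' q] by (cases "q < q'") auto
    next
      case 2
      then show ?thesis using MT[of q] by simp
    next
      case 3
      then show ?thesis using MT[of q] by (simp add: Int_commute)
    qed
  qed
  have "block_sum S = rev_coeff n w"
  proof
    fix j
    show "block_sum S j = rev_coeff n w j"
    proof (cases "1 \<le> j \<and> j \<le> n")
      case False
      have "block_sum S j = 0"
      proof (rule block_sum_zero)
        fix \<zeta> a b assume "(\<zeta>, a, b) \<in> S"
        then consider q where "q \<in> M" "a = Suc n - q" "b = Suc n - ?p q" | "a = 1" "b = ?m n"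
          by (auto simp: S_def split: if_splits)
        then have "1 \<le> a \<and> b \<le> n"
        proof cases
          case 1
          with M(1,3)[OF 1(1)] show ?thesis by linarith
        next
          case 2
          with match_len_le[of ?\<beta> w n] show ?thesis by simp
        qed
        then show "\<not> (a \<le> j \<and> j \<le> b)" using False by auto
      qed
      then show ?thesis using False by (auto simp: rev_coeff_def)
    next
      case True
      define k where "k = Suc n - j"
      have k: "1 \<le> k" "k \<le> n" "j = Suc n - k" using True by (auto simp: k_def)
      show ?thesis
      proof (cases "\<exists>q. k \<le> q \<and> q \<le> n \<and> ?m q = 0")
        case True
        then obtain q where "k \<le> q" "q \<le> n" "?m q = 0" by blast
        then obtain q' where q': "k \<le> q'" "q' \<le> q" "?m q' = 0" "?p q' \<le> k"
          using ex_block_end[of k q ?\<beta> w] k by metis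
        have "(Z q', Suc n - q', Suc n - ?p q') \<in> S"
          using q' k \<open>q \<le> n\<close> by (auto simp: S_def M_def)
        from block_sum_eq[OF disj this] q' k show ?thesis by (auto simp: Z_def rev_coeff_def)
      next
        case False
        \<comment> \<open>No reset occurs from \<open>k\<close> to \<open>n\<close>, so
          \<open>k\<close> belongs to the unfinished match at the end.\<close>
        then have m: "?m n = ?m (k - 1) + (Suc n - k)"
          using match_len_run[of "k - 1" "Suc n - k" ?\<beta> w] k by auto
        then have "(max_block L (Suc (?m n)), 1, ?m n) \<in> S" using k by (auto simp: S_def)
        from block_sum_eq[OF disj this] m k
        have "block_sum S j = ?\<beta> (Suc (?m n) - j)" by (auto simp: max_block_eq)
        also have "\<dots> = w k"
        proof -
          have le: "?m n \<le> n" by (rule match_len_le)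
          have "w k = ?\<beta> (k - (n - ?m n))"
            by (rule match_len_digits) (use m k le in auto)
          moreover have "k - (n - ?m n) = Suc (?m n) - j" using m k le by auto
          ultimately show ?thesis by simp
        qed
        finally show ?thesis using True k by (simp add: rev_coeff_def)
      qed
    qed
  qed
  moreover have "finite S" by (auto simp: S_def M_def)
  moreover have "\<forall>(\<zeta>, a, b) \<in> S. zeck_block L \<zeta> a b"
    using blk by (auto simp: S_def zeck_block_iff)
  ultimately show ?thesis using disj unfolding zeck_coll_def by (intro CollectI exI[of _ S]) simp
qed

lemma zeck_coll_bounds:
  assumes "\<mu> \<in> zeck_coll L" "zeck_list L"
  shows "\<exists>K. \<forall>j>K. \<mu> j = 0" "\<mu> j \<le> Max (set L)"
proof -
  from assms obtain S where S: "\<mu> = block_sum S" "finite S"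
    "\<And>\<zeta> a b. (\<zeta>, a, b) \<in> S \<Longrightarrow> zeck_block L \<zeta> a b" "disjoint_supports S"
    unfolding zeck_coll_def by blast
  show "\<exists>K. \<forall>j>K. \<mu> j = 0"
  proof (intro exI allI impI)
    fix j assume j: "(\<Sum>(\<zeta>, a, b)\<in>S. b) < j"
    \<comment> \<open>The sum of all right end points serves as a common bound for them.\<close>
    have "b < j" if "(\<zeta>, a, b) \<in> S" for \<zeta> a b
      using member_le_sum[OF that, of "\<lambda>(\<zeta>, a, b). b"] S(2) j by simp
    then show "\<mu> j = 0" unfolding S(1) by (intro block_sum_zero) force
  qed
  have max: "beta_star L (Suc i) \<le> Max (set L)" for i
    using assms(2) by (auto simp: beta_star_Suc zeck_list_def intro!: Max_ge nth_mem mod_less_divisor)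
  show "\<mu> j \<le> Max (set L)"
  proof (cases "\<exists>\<zeta> a b. (\<zeta>, a, b) \<in> S \<and> a \<le> j \<and> j \<le> b")
    case True
    then obtain \<zeta> a b where t: "(\<zeta>, a, b) \<in> S" "a \<le> j" "j \<le> b" by blast
    have "\<zeta> j \<le> beta_star L (Suc (b - j))"
      using zeck_blockD(3,4)[OF S(3)[OF t(1)]] t by (cases "a = j") auto
    then show ?thesis using block_sum_eq[OF S(4) t] max S(1) le_trans by metis
  next
    case False
    then have "\<mu> j = 0" unfolding S(1) by (intro block_sum_zero) blast
    then show ?thesis by simp
  qed
qed

lemma zeck_coll_admissible:
  assumes L: "zeck_list L" and \<mu>: "\<mu> \<in> zeck_coll L" and n: "\<And>j. n < j \<Longrightarrow> \<mu> j = 0"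
  shows "admissible (beta_star L) n (rev_coeff n \<mu>)"
proof -
  from \<mu> obtain S where S: "\<mu> = block_sum S" "finite S"
    "\<And>\<zeta> a b. (\<zeta>, a, b) \<in> S \<Longrightarrow> zeck_block L \<zeta> a b" "disjoint_supports S"
    unfolding zeck_coll_def by blast
  \<comment> \<open>Zero blocks may be supported beyond \<open>n\<close>, so the word is first read
    in a window that contains all supports.\<close>
  define m where "m = n + (\<Sum>(\<zeta>, a, b)\<in>S. b)"
  have bm: "b \<le> m" if "(\<zeta>, a, b) \<in> S" for \<zeta> a b
    using member_le_sum[OF that, of "\<lambda>(\<zeta>, a, b). b"] S(2) by (simp add: m_def)
  \<comment> \<open>A proper block ends in a reset at the reflection of its lower end. A maximal one
    runs to the last digit without reset, so its end is put at \<open>Suc m\<close>, just outside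
    the window.\<close>
  let ?P = "\<lambda>(\<zeta> :: coeff_fun, a :: nat, b). Suc m - b"
    and ?Q = "\<lambda>(\<zeta>, a, b). if proper_block L \<zeta> a b then Suc m - a else Suc m"
  let ?w = "rev_coeff m \<mu>"
  have w: "?w j = \<zeta> (Suc m - j)" if "(\<zeta>, a, b) \<in> S" "Suc m - b \<le> j" "j \<le> Suc m - a" for \<zeta> a b j
  proof -
    have "a \<le> Suc m - j" "Suc m - j \<le> b" "1 \<le> j" "j \<le> m"
      using that zeck_blockD(1,2)[OF S(3)[OF that(1)]] bm[OF that(1)] by auto
    then show ?thesis using block_sum_eq[OF S(4) that(1), of "Suc m - j"]
      by (simp add: rev_coeff_def S(1))
  qed
  have "admissible (beta_star L) m ?w"
  proof (rule admissible_blocks(1)[of S ?P ?Q])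
    fix t assume "t \<in> S"
    then obtain \<zeta> a b where t: "t = (\<zeta>, a, b)" "(\<zeta>, a, b) \<in> S" by (cases t) auto
    note D = zeck_blockD[OF S(3)[OF t(2)]]
    have b: "b \<le> m" using bm t by blast
    show "1 \<le> ?P t \<and> ?P t \<le> ?Q t" using D b t by auto
    show "?w j = beta_star L (Suc (j - ?P t))" if "?P t \<le> j" "j < ?Q t" "j \<le> m" for j
    proof -
      have j: "Suc m - b \<le> j" "j \<le> Suc m - a"
        using that t D(5) by (auto split: if_splits)
      have e: "b - (Suc m - j) = j - (Suc m - b)" using j b D(1,2) by auto
      show ?thesis
      proof (cases "a < Suc m - j")
        case True
        then show ?thesis using w[OF t(2) j] D(3)[of "Suc m - j"] j e t by auto
      next
        case False
        then have "Suc m - j = a" using j D(1,2) b by auto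
        moreover have "\<not> proper_block L \<zeta> a b" using that t False D(1,2) b by (auto split: if_splits)
        ultimately show ?thesis using w[OF t(2) j] D(5) e t by auto
      qed
    qed
    show "?w (?Q t) < beta_star L (Suc (?Q t - ?P t))" if "?Q t \<le> m"
    proof -
      have p: "proper_block L \<zeta> a b" using that t by (auto split: if_splits)
      have "?w (Suc m - a) = \<zeta> a" using w[OF t(2), of "Suc m - a"] D(1,2) b by auto
      moreover have "Suc m - a - (Suc m - b) = b - a" using D(1,2) b by auto
      ultimately show ?thesis using proper_blockD(4)[OF p] p t by simp
    qed
  next
    fix t t' j assume tt: "t \<in> S" "t' \<in> S" "?P t \<le> j" "j \<le> ?Q t" "?P t' \<le> j" "j \<le> ?Q t'"
    obtain \<zeta> a b \<zeta>' a' b' where t: "t = (\<zeta>, a, b)" "t' = (\<zeta>', a', b')" by (cases t, cases t')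
    note D = zeck_blockD[OF S(3), of \<zeta> a b] and D' = zeck_blockD[OF S(3), of \<zeta>' a' b']
    have b: "b \<le> m" "b' \<le> m" using bm tt t by blast+
    have s: "1 \<le> a" "a \<le> b" "1 \<le> a'" "a' \<le> b'"
      using D(1,2) D'(1,2) tt(1,2) t by auto
    show "t = t'"
    proof (cases "j = Suc m")
      case True
      \<comment> \<open>Only maximal blocks reach the fictitious position \<open>Suc m\<close>, and
        any two of them share position 1.\<close>
      then have "a = 1" "a' = 1" using D(5) D'(5) tt t s by (auto split: if_splits)
      then show ?thesis using disjoint_supports_unique[OF S(4), of \<zeta> a b \<zeta>' a' b' 1] tt t s by auto
    next
      case False
      have "a \<le> Suc m - j" "a' \<le> Suc m - j"
        using False D(5) D'(5) tt t b by (auto split: if_splits)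
      then show ?thesis
        using disjoint_supports_unique[OF S(4), of \<zeta> a b \<zeta>' a' b' "Suc m - j"] tt t b by auto
    qed
  next
    fix j assume j: "1 \<le> j" "j \<le> m" "\<And>t. t \<in> S \<Longrightarrow> \<not> (?P t \<le> j \<and> j \<le> ?Q t)"
    have "block_sum S (Suc m - j) = 0"
    proof (rule block_sum_zero)
      fix \<zeta> a b assume t: "(\<zeta>, a, b) \<in> S"
      show "\<not> (a \<le> Suc m - j \<and> Suc m - j \<le> b)"
        using j(1,2) j(3)[OF t] by (auto split: if_splits)
    qed
    then show "?w j = 0" using j by (simp add: rev_coeff_def S(1))
  qed (rule beta_star_1_pos[OF L])
  then have "admissible (beta_star L) n (\<lambda>j. ?w (j + (m - n)))"
    by (intro admissible_shift beta_star_1_pos[OF L]) (auto simp: rev_coeff_def m_def intro!: n)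
  moreover have "?w (j + (m - n)) = rev_coeff n \<mu> j" if "1 \<le> j" "j \<le> n" for j
    using that by (auto simp: rev_coeff_def m_def)
  ultimately show ?thesis using admissible_cong[of n "\<lambda>j. ?w (j + (m - n))" "rev_coeff n \<mu>"] by blast
qed

section \<open>Fixed points of the rounding operations\<close>

lemma less_asc_trans: "less_asc a b \<Longrightarrow> less_asc b c \<Longrightarrow> less_asc a c"
  unfolding less_asc_def
proof (elim exE conjE)
  fix k l
  assume *: "a k < b k" "\<forall>j>k. a j = b j" "b l < c l" "\<forall>j>l. b j = c j"
  show "\<exists>k. a k < c k \<and> (\<forall>j>k. a j = c j)"
    using * by (intro exI[of _ "max k l"]) (cases k l rule: linorder_cases; simp add: max_def)
qed

lemma less_asc_irrefl: "\<not> less_asc a a"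
  by (auto simp: less_asc_def)

lemma less_asc_total:
  assumes "\<forall>j>K. a j = 0" "\<forall>j>K'. b j = 0" "a \<noteq> b"
  shows "less_asc a b \<or> less_asc b a"
proof -
  let ?D = "{j. a j \<noteq> b j}"
  have "?D \<subseteq> {..max K K'}" using assms(1,2) by (force simp: not_less[symmetric])
  then have fin: "finite ?D" by (rule finite_subset) simp
  have ne: "?D \<noteq> {}" using assms(3) by auto
  have "Max ?D \<in> ?D" by (rule Max_in[OF fin ne])
  moreover have "a j = b j" if "Max ?D < j" for j
    using Max_ge[OF fin, of j] that by force
  ultimately show ?thesis unfolding less_asc_def
    by (metis (mono_tags, lifting) linorder_neqE_nat mem_Collect_eq)
qed

text \<open>For \<open>\<mu>\<close> in the collection, \<open>zeck_check L \<mu>\<close> is its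
  predecessor there, and the successor of the predecessor is \<open>\<mu>\<close> again. The point
  is that the predecessor exists.\<close>

lemma zeck_bar_id:
  assumes L: "zeck_list L" and \<mu>: "\<mu> \<in> zeck_coll L" "\<mu> \<noteq> (\<lambda>_. 0)"
  shows "zeck_bar L \<mu> = \<mu>"
proof -
  define A where "A = {\<nu> \<in> zeck_coll L. less_asc \<nu> \<mu>}"
  have tot: "less_asc a b \<or> less_asc b a" if "a \<in> zeck_coll L" "b \<in> zeck_coll L" "a \<noteq> b" for a b
    using zeck_coll_bounds(1)[OF that(1) L] zeck_coll_bounds(1)[OF that(2) L] less_asc_total that(3)
    by blast
  obtain K where K: "\<forall>j>K. \<mu> j = 0" using zeck_coll_bounds(1)[OF \<mu>(1) L] by blast
  \<comment> \<open>A smaller member also vanishes beyond \<open>K\<close>, and its digits are at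
    most \<open>Max (set L)\<close>. So only finitely many members lie below \<open>\<mu>\<close>;
    as 0 is among them, there is a greatest one.\<close>
  have "A \<subseteq> {f. \<forall>x. (x \<in> {..K} \<longrightarrow> f x \<in> {..Max (set L)}) \<and> (x \<notin> {..K} \<longrightarrow> f x = 0)}"
  proof
    fix \<nu> assume "\<nu> \<in> A"
    then have \<nu>: "\<nu> \<in> zeck_coll L" "less_asc \<nu> \<mu>" by (auto simp: A_def)
    then obtain k where k: "\<nu> k < \<mu> k" "\<forall>j>k. \<nu> j = \<mu> j" by (auto simp: less_asc_def)
    have "k \<le> K" using K k(1) by (force simp: not_less[symmetric])
    then have "\<nu> j = 0" if "K < j" for j using k K that by simp
    then show "\<nu> \<in> {f. \<forall>x. (x \<in> {..K} \<longrightarrow> f x \<in> {..Max (set L)}) \<and> (x \<notin> {..K} \<longrightarrow> f x = 0)}"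
      using zeck_coll_bounds(2)[OF \<nu>(1) L] by auto
  qed
  moreover have "finite {f. \<forall>x. (x \<in> {..K} \<longrightarrow> f x \<in> {..Max (set L)}) \<and> (x \<notin> {..K} \<longrightarrow> f x = (0::nat))}"
    by (rule finite_set_of_finite_funs) auto
  ultimately have finA: "finite A" by (rule finite_subset)
  have "(\<lambda>_. 0) \<in> zeck_coll L"
  proof -
    have "(\<lambda>_. 0) = block_sum {}" by (rule ext, rule sym, rule block_sum_zero) simp
    then show ?thesis unfolding zeck_coll_def
      by (intro CollectI exI[of _ "{}"]) (simp add: disjoint_supports_def disjoint_family_on_def)
  qed
  moreover have "less_asc (\<lambda>_. 0) \<mu>"
    using tot[OF calculation \<mu>(1)] \<mu>(2) by (auto simp: less_asc_def)
  ultimately have neA: "A \<noteq> {}" by (auto simp: A_def)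
  have "\<exists>c\<in>A. \<forall>x\<in>A. x \<noteq> c \<longrightarrow> less_asc x c"
  proof (rule Finite_Set.bex_greatest_element[OF finA])
    show "transp_on A less_asc" by (rule transp_onI) (rule less_asc_trans)
    show "totalp_on A less_asc" by (rule totalp_onI) (use tot in \<open>auto simp: A_def\<close>)
  qed (rule neA)
  then obtain c where c: "c \<in> A" "\<And>x. x \<in> A \<Longrightarrow> x = c \<or> less_asc x c" by blast
  have check: "zeck_check L \<mu> = c"
    unfolding zeck_check_def
  proof (rule the_equality)
    show "c \<in> zeck_coll L \<and> less_asc c \<mu> \<and> (\<forall>\<nu>'\<in>zeck_coll L. less_asc \<nu>' \<mu> \<longrightarrow> \<nu>' = c \<or> less_asc \<nu>' c)"
      using c by (auto simp: A_def)
    fix d assume "d \<in> zeck_coll L \<and> less_asc d \<mu> \<and> (\<forall>\<nu>'\<in>zeck_coll L. less_asc \<nu>' \<mu> \<longrightarrow> \<nu>' = d \<or> less_asc \<nu>' d)"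
    then show "d = c" using c less_asc_trans less_asc_irrefl unfolding A_def by blast
  qed
  have c\<mu>: "less_asc c \<mu>" using c by (auto simp: A_def)
  have least: "\<nu> = \<mu> \<or> less_asc \<mu> \<nu>" if "\<nu> \<in> zeck_coll L" "less_asc c \<nu>" for \<nu>
    using tot[OF that(1) \<mu>(1)] c(2)[of \<nu>] that less_asc_trans less_asc_irrefl unfolding A_def by blast
  show ?thesis
    unfolding zeck_bar_def check
  proof (rule the_equality)
    show "\<mu> \<in> zeck_coll L \<and> less_asc c \<mu> \<and> (\<forall>\<nu>'\<in>zeck_coll L. less_asc c \<nu>' \<longrightarrow> \<nu>' = \<mu> \<or> less_asc \<mu> \<nu>')"
      using \<mu> c\<mu> least by blast
    fix d assume "d \<in> zeck_coll L \<and> less_asc c d \<and> (\<forall>\<nu>'\<in>zeck_coll L. less_asc c \<nu>' \<longrightarrow> \<nu>' = d \<or> less_asc d \<nu>')"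
    then show "d = \<mu>" using \<mu>(1) c\<mu> least less_asc_trans less_asc_irrefl by blast
  qed
qed

text \<open>Up to the first difference \<open>w\<close> agrees with \<open>beta_star L\<close>, so
  all digits read so far are matched and the next one is bounded by the corresponding digit of
  \<open>beta_star L\<close>.\<close>

lemma admissible_not_above:
  assumes "\<And>n. admissible (beta_star L) n w" "w 0 = 0"
  shows "\<not> less_desc (star_max_block L 1) w"
proof
  have smb: "star_max_block L 1 j = beta_star L j" for j
    by (cases j) (simp_all add: star_max_block_eq beta_star_def)
  assume "less_desc (star_max_block L 1) w"
  then obtain k where k: "beta_star L k < w k" "\<forall>j<k. beta_star L j = w j"
    unfolding less_desc_def smb by blast
  have run: "match_len (beta_star L) w i = i" if "i < k" for i
    using that by (induction i) (auto simp: k(2))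
  obtain i where i: "k = Suc i" using k(1) assms(2) by (cases k) auto
  have "w (Suc i) \<le> beta_star L (Suc (match_len (beta_star L) w i))"
    using assms(1)[of "Suc i"] by (simp add: admissible_def)
  then show False using run[of i] k(1) i by simp
qed

text \<open>Every reversed prefix lies in the collection and is fixed by \<open>zeck_bar\<close>
  once it is nonzero; reversing again recovers the digits of \<open>w\<close>, so each entry is
  eventually constant in \<open>n\<close>.\<close>

lemma rev_bar_id:
  assumes L: "zeck_list L" and w: "\<And>n. admissible (beta_star L) n w" "w 0 = 0" "w \<noteq> (\<lambda>_. 0)"
  shows "rev_bar L w = w"
proof (cases "w = star_max_block L 1")
  case True
  then show ?thesis by (simp add: rev_bar_def)
next
  case False
  from w(3) obtain m where m: "w m \<noteq> 0" by auto
  then have "1 \<le> m" using w(2) by (cases m) auto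
  have "lim (\<lambda>n. rev_coeff n (zeck_bar L (rev_coeff n w)) k) = w k" for k
  proof (rule limI, rule tendsto_eventually)
    show "\<forall>\<^sub>F n in sequentially. rev_coeff n (zeck_bar L (rev_coeff n w)) k = w k"
      using eventually_ge_at_top[of "max m k"]
    proof eventually_elim
      case (elim n)
      have "rev_coeff n w (Suc n - m) = w m"
        using elim \<open>1 \<le> m\<close> by (auto simp: rev_coeff_def)
      then have "rev_coeff n w \<noteq> (\<lambda>_. 0)" using m by metis
      with zeck_bar_id[OF L rev_coeff_in_zeck_coll[OF w(1)]]
      have "zeck_bar L (rev_coeff n w) = rev_coeff n w" .
      moreover have "rev_coeff n (rev_coeff n w) k = w k"
        using rev_coeff_rev_coeff[of k n w] elim w(2) by (cases k) (auto simp: rev_coeff_def)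
      ultimately show ?case by simp
    qed
  qed
  then show ?thesis using False admissible_not_above[OF w(1,2)] by (simp add: rev_bar_def)
qed

text \<open>The inclusion speaks of finite words read from the bottom, so the prefix is reversed,
  moved into the larger collection and reversed back.\<close>

lemma admissible_subset:
  assumes L: "zeck_list Lt" and sub: "zeck_coll L \<subseteq> zeck_coll Lt" and w: "admissible (beta_star L) n w"
  shows "admissible (beta_star Lt) n w"
proof -
  have "rev_coeff n w \<in> zeck_coll Lt" using rev_coeff_in_zeck_coll[OF w] sub by blast
  then have "admissible (beta_star Lt) n (rev_coeff n (rev_coeff n w))"
    by (rule zeck_coll_admissible[OF L]) (simp add: rev_coeff_def)
  then show ?thesis
    using admissible_cong[of n "rev_coeff n (rev_coeff n w)" w] rev_coeff_rev_coeff by blast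
qed

lemma zeck_coll_cong: "beta_star L = beta_star L' \<Longrightarrow> zeck_coll L = zeck_coll L'"
  by (simp add: zeck_coll_def zeck_block_def proper_block_def max_block_def)

section \<open>Values of admissible words\<close>

text \<open>An expansion \<open>\<beta>\<close> of 1 in base \<open>1 / u\<close> without a zero
  tail; the estimates of values below rest on this.\<close>

locale greedy_base =
  fixes \<beta> :: coeff_fun and u :: real
  assumes u: "0 < u" "u < 1"
    and sums_1: "(\<lambda>k. real (\<beta> (Suc k)) * u ^ Suc k) sums 1"
    and frequently_pos: "\<exists>j\<ge>k. 0 < \<beta> (Suc j)"
begin

text \<open>By \<open>sums_1\<close> this is the value of \<open>\<beta>\<close> with its first
  \<open>s\<close> digits dropped, expressed by a finite sum.\<close>

definition rest :: "nat \<Rightarrow> real" where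
  "rest s = (1 - (\<Sum>k<s. real (\<beta> (Suc k)) * u ^ Suc k)) / u ^ s"

text \<open>The largest value that a word with the first \<open>n\<close> digits of \<open>w\<close> can have.\<close>

definition potential :: "coeff_fun \<Rightarrow> nat \<Rightarrow> real" where
  "potential w n = (\<Sum>k<n. real (w (Suc k)) * u ^ Suc k) + u ^ n * rest (match_len \<beta> w n)"

lemma rest_0: "rest 0 = 1"
  by (simp add: rest_def)

lemma rest_pos: "0 < rest s"
proof -
  obtain j where "j \<ge> s" "0 < \<beta> (Suc j)" using frequently_pos by blast
  then have "(\<Sum>k<s. real (\<beta> (Suc k)) * u ^ Suc k) < (\<Sum>k. real (\<beta> (Suc k)) * u ^ Suc k)"
    using sums_1 u by (intro sum_less_suminf2[of _ _ j]) (auto simp: sums_iff)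
  then show ?thesis using sums_1 u by (simp add: rest_def sums_iff)
qed

lemma rest_Suc: "rest s = u * (real (\<beta> (Suc s)) + rest (Suc s))"
  using u by (simp add: rest_def field_simps)

lemma potential_0: "potential w 0 = 1"
  by (simp add: potential_def rest_0)

text \<open>By \<open>rest_Suc\<close>, extending the match leaves the potential unchanged. A
  smaller digit loses at least one unit at its place; the reset returns \<open>rest 0 = 1\<close>
  such unit but gives up the positive \<open>rest\<close> of the longer match.\<close>

lemma potential_Suc:
  assumes "w (Suc n) \<le> \<beta> (Suc (match_len \<beta> w n))"
  shows "potential w (Suc n) \<le> potential w n"
    and "match_len \<beta> w (Suc n) = 0 \<Longrightarrow> potential w (Suc n) < potential w n"
proof -
  let ?s = "match_len \<beta> w n"
  have eq: "potential w (Suc n) - potential w n =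
      u ^ Suc n * (real (w (Suc n)) + rest (match_len \<beta> w (Suc n)) - (real (\<beta> (Suc ?s)) + rest (Suc ?s)))"
    unfolding potential_def rest_Suc[of ?s] by (simp add: algebra_simps del: match_len.simps)
  have pos: "0 < u ^ Suc n" using u by simp
  have less: "potential w (Suc n) < potential w n" if "match_len \<beta> w (Suc n) = 0"
  proof -
    have "w (Suc n) \<noteq> \<beta> (Suc ?s)" using that by auto
    then have "real (w (Suc n)) + 1 \<le> real (\<beta> (Suc ?s))" using assms by linarith
    then have "real (w (Suc n)) + rest (match_len \<beta> w (Suc n)) - (real (\<beta> (Suc ?s)) + rest (Suc ?s)) < 0"
      unfolding that rest_0 using rest_pos[of "Suc ?s"] by linarith
    then have "potential w (Suc n) - potential w n < 0"
      unfolding eq using pos by (rule mult_pos_neg[rotated])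
    then show ?thesis by simp
  qed
  then show "match_len \<beta> w (Suc n) = 0 \<Longrightarrow> potential w (Suc n) < potential w n" .
  show "potential w (Suc n) \<le> potential w n"
  proof (cases "w (Suc n) = \<beta> (Suc ?s)")
    case True
    then have "potential w (Suc n) - potential w n = 0" unfolding eq by simp
    then show ?thesis by simp
  next
    case False
    then show ?thesis using less by simp
  qed
qed

lemma potential_antimono:
  assumes "\<And>n. admissible \<beta> n w" "m \<le> n"
  shows "potential w n \<le> potential w m"
  using assms(2)
proof (induction n rule: dec_induct)
  case (step n)
  have "w (Suc n) \<le> \<beta> (Suc (match_len \<beta> w n))"
    using assms(1)[of "Suc n"] by (simp add: admissible_def)
  then show ?case using potential_Suc(1) step.IH by fastforce
qed simp

lemma partial_sum_le_potential:
  assumes "\<And>n. admissible \<beta> n w"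
  shows "(\<Sum>k<n. real (w (Suc k)) * u ^ Suc k) \<le> potential w m"
proof -
  have "(\<Sum>k<n. real (w (Suc k)) * u ^ Suc k) \<le> (\<Sum>k<max m n. real (w (Suc k)) * u ^ Suc k)"
    using u by (intro sum_mono2) auto
  also have "\<dots> \<le> potential w (max m n)"
    using u rest_pos by (simp add: potential_def less_imp_le)
  also have "\<dots> \<le> potential w m" using assms by (rule potential_antimono) simp
  finally show ?thesis .
qed

lemma summable_digits:
  assumes "\<And>n. admissible \<beta> n w"
  shows "summable (\<lambda>k. real (w (Suc k)) * u ^ Suc k)"
  by (rule summableI_nonneg_bounded[of _ "potential w 0"])
    (use u partial_sum_le_potential[OF assms] in auto)

lemma coeff_sum_le_potential:
  assumes "\<And>n. admissible \<beta> n w"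
  shows "coeff_sum w (\<lambda>n. u ^ n) \<le> potential w m"
  unfolding coeff_sum_def
  by (rule suminf_le_const[OF summable_digits[OF assms] partial_sum_le_potential[OF assms]])

text \<open>The potential bounds the value at every stage and drops strictly at the reset
  \<open>q\<close>, which comes after \<open>m\<close>.\<close>

lemma coeff_sum_less_potential:
  assumes "\<And>n. admissible \<beta> n w" "m < q" "match_len \<beta> w q = 0"
  shows "coeff_sum w (\<lambda>n. u ^ n) < potential w m"
proof -
  obtain r where r: "q = Suc r" using assms(2) by (cases q) auto
  have "coeff_sum w (\<lambda>n. u ^ n) \<le> potential w (Suc r)" by (rule coeff_sum_le_potential[OF assms(1)])
  also have "\<dots> < potential w r"
    using potential_Suc(2)[of w r] assms(1)[of "Suc r"] assms(3) by (simp add: admissible_def r del: match_len.simps)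
  also have "\<dots> \<le> potential w m" using assms r by (intro potential_antimono) auto
  finally show ?thesis .
qed

lemma coeff_sum_less_1:
  assumes "\<And>n. admissible \<beta> n w" "0 < q" "match_len \<beta> w q = 0"
  shows "coeff_sum w (\<lambda>n. u ^ n) < 1"
  using coeff_sum_less_potential[OF assms] by (simp add: potential_0)

lemma partial_sum_le_coeff_sum:
  assumes "\<And>n. admissible \<beta> n w"
  shows "(\<Sum>k<n. real (w (Suc k)) * u ^ Suc k) \<le> coeff_sum w (\<lambda>n. u ^ n)"
  unfolding coeff_sum_def
  by (rule sum_le_suminf[OF summable_digits[OF assms]]) (use u in auto)

lemma digit_le_coeff_sum:
  assumes "\<And>n. admissible \<beta> n w" "1 \<le> k"
  shows "real (w k) * u ^ k \<le> coeff_sum w (\<lambda>n. u ^ n)"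
proof -
  obtain i where i: "k = Suc i" using assms(2) by (cases k) auto
  have "real (w (Suc i)) * u ^ Suc i \<le> (\<Sum>k<Suc i. real (w (Suc k)) * u ^ Suc k)"
    using u by (intro member_le_sum[of i]) auto
  also have "\<dots> \<le> coeff_sum w (\<lambda>n. u ^ n)" by (rule partial_sum_le_coeff_sum[OF assms(1)])
  finally show ?thesis using i by simp
qed

text \<open>At the first difference the digit of \<open>w\<close> lies below an allowed one, so
  \<open>w\<close> resets there. Its remaining digits are then worth less than one unit at that
  place, strictly so by a later reset, and \<open>w'\<close> gains at least this unit.\<close>

lemma coeff_sum_less_lex:
  assumes w: "\<And>n. admissible \<beta> n w" "\<And>k. \<exists>q\<ge>k. match_len \<beta> w q = 0"
    and w': "\<And>n. admissible \<beta> n w'"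
    and k: "w (Suc k) < w' (Suc k)" "\<And>j. 1 \<le> j \<Longrightarrow> j \<le> k \<Longrightarrow> w j = w' j"
  shows "coeff_sum w (\<lambda>n. u ^ n) < coeff_sum w' (\<lambda>n. u ^ n)"
proof -
  have "match_len \<beta> w k = match_len \<beta> w' k" using k(2) by (rule match_len_cong)
  moreover have "w' (Suc k) \<le> \<beta> (Suc (match_len \<beta> w' k))"
    using w'[of "Suc k"] by (simp add: admissible_def)
  ultimately have state: "match_len \<beta> w (Suc k) = 0" using k(1) by simp
  obtain q where q: "Suc (Suc k) \<le> q" "match_len \<beta> w q = 0" using w(2) by blast
  have "coeff_sum w (\<lambda>n. u ^ n) < potential w (Suc k)"
    by (rule coeff_sum_less_potential[OF w(1) _ q(2)]) (use q in simp)
  also have "\<dots> = (\<Sum>j<k. real (w (Suc j)) * u ^ Suc j) + (real (w (Suc k)) + 1) * u ^ Suc k"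
    unfolding potential_def state rest_0 by (simp add: algebra_simps)
  also have "\<dots> \<le> (\<Sum>j<k. real (w (Suc j)) * u ^ Suc j) + real (w' (Suc k)) * u ^ Suc k"
    using k(1) u by (intro add_left_mono mult_right_mono) auto
  also have "\<dots> = (\<Sum>j<Suc k. real (w' (Suc j)) * u ^ Suc j)"
    using k(2) by simp
  also have "\<dots> \<le> coeff_sum w' (\<lambda>n. u ^ n)" by (rule partial_sum_le_coeff_sum[OF w'])
  finally show ?thesis .
qed

lemma coeff_sum_inj:
  assumes w: "\<And>n. admissible \<beta> n w" "\<And>k. \<exists>q\<ge>k. match_len \<beta> w q = 0" "w 0 = 0"
    and w': "\<And>n. admissible \<beta> n w'" "\<And>k. \<exists>q\<ge>k. match_len \<beta> w' q = 0" "w' 0 = 0"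
    and eq: "coeff_sum w (\<lambda>n. u ^ n) = coeff_sum w' (\<lambda>n. u ^ n)"
  shows "w = w'"
proof (rule ccontr)
  assume "w \<noteq> w'"
  then have ex: "\<exists>j. w j \<noteq> w' j" by auto
  define j where "j = (LEAST j. w j \<noteq> w' j)"
  have j: "w j \<noteq> w' j" unfolding j_def using ex by (rule LeastI_ex)
  have below: "w i = w' i" if "i < j" for i using not_less_Least that unfolding j_def by blast
  obtain k where k: "j = Suc k" using j w(3) w'(3) by (cases j) auto
  have "w i = w' i" "w' i = w i" if "i \<le> k" for i using below that k by auto
  then show False
    using coeff_sum_less_lex[OF w(1,2) w'(1), of k] coeff_sum_less_lex[OF w'(1,2) w(1), of k] eq j k
    by (metis linorder_neqE_nat order_less_irrefl)
qed

text \<open>Without a reset from \<open>n\<close> on, the zeros would have to match all later digits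
  of \<open>\<beta>\<close>, infinitely many of which are positive.\<close>

lemma zero_tail_state:
  assumes "\<And>j. K < j \<Longrightarrow> w j = 0"
  shows "\<exists>q\<ge>n. match_len \<beta> w q = 0"
proof (rule ccontr)
  assume no: "\<not> ?thesis"
  let ?m = "max n K"
  have run: "match_len \<beta> w (?m + i) = match_len \<beta> w ?m + i" for i
  proof (induction i)
    case (Suc i)
    have "match_len \<beta> w (Suc (?m + i)) \<noteq> 0" using no by (auto simp del: match_len.simps)
    then show ?case using Suc by (simp split: if_splits)
  qed simp
  obtain j where j: "match_len \<beta> w ?m \<le> j" "0 < \<beta> (Suc j)" using frequently_pos by blast
  \<comment> \<open>A run without resets passes through state \<open>j\<close> after
    \<open>i\<close> steps, and there the digit 0 is a mismatch.\<close>
  define i where "i = j - match_len \<beta> w ?m"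
  have i: "match_len \<beta> w (?m + i) = j" using run[of i] j(1) by (simp only: i_def le_add_diff_inverse)
  have "w (Suc (?m + i)) = 0" by (rule assms) auto
  then have "match_len \<beta> w (Suc (?m + i)) = 0" using i j(2) by simp
  moreover have "n \<le> Suc (?m + i)" by auto
  ultimately show False using no by blast
qed

end

section \<open>The zero of the polynomial as a base\<close>

lemma zeck_root_props:
  assumes L: "zeck_list L"
  shows "1 < zeck_root L"
    and "(\<Sum>k<length L. real (L ! k) * (1 / zeck_root L) ^ Suc k) + (1 / zeck_root L) ^ length L = 1"
proof -
  define N where "N = length L"
  have N: "2 \<le> N" and L0: "0 < L ! 0" using L by (auto simp: N_def zeck_list_def)
  \<comment> \<open>Division by \<open>x ^ N\<close> turns the polynomial equation into
    \<open>h (1 / x) = 1\<close>. With nonnegative coefficients, \<open>h\<close> increases strictly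
    from 0 at 0 to at least 2 at 1, so \<open>1 / x\<close> is unique and lies strictly between 0
    and 1.\<close>
  define h where "h x = (\<Sum>k<N. real (L ! k) * x ^ Suc k) + x ^ N" for x :: real
  define P where "P x \<longleftrightarrow> 0 < x \<and> x ^ N - (\<Sum>k = 1..N - 1. real (L ! (k - 1)) * x ^ (N - k))
       - (1 + real (L ! (N - 1))) = 0" for x :: real
  have root: "zeck_root L = (THE x. P x)" by (simp add: zeck_root_def P_def N_def)
  have P_iff: "P x \<longleftrightarrow> 0 < x \<and> h (1 / x) = 1" for x
  proof (cases "0 < x")
    case True
    have "x ^ N * h (1 / x) = (\<Sum>k<N. real (L ! k) * x ^ (N - Suc k)) + 1"
      using True unfolding h_def distrib_left sum_distrib_left
      by (auto intro!: sum.cong simp: power_one_over field_simps power_diff simp flip: power_Suc)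
    also have "(\<Sum>k<N. real (L ! k) * x ^ (N - Suc k)) =
        (\<Sum>k<N - 1. real (L ! k) * x ^ (N - Suc k)) + real (L ! (N - 1))"
      using N by (cases N) auto
    also have "(\<Sum>k<N - 1. real (L ! k) * x ^ (N - Suc k)) =
        (\<Sum>k = 1..N - 1. real (L ! (k - 1)) * x ^ (N - k))"
      by (rule sum.reindex_bij_witness[of _ "\<lambda>k. k - 1" Suc]) auto
    finally have "x ^ N * h (1 / x) - x ^ N = - (x ^ N - (\<Sum>k = 1..N - 1. real (L ! (k - 1)) * x ^ (N - k))
       - (1 + real (L ! (N - 1))))" by simp
    moreover have "x ^ N * h (1 / x) - x ^ N = x ^ N * (h (1 / x) - 1)" by (simp add: algebra_simps)
    ultimately have "P x \<longleftrightarrow> x ^ N * (h (1 / x) - 1) = 0" using True by (auto simp: P_def)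
    then show ?thesis using True by simp
  qed (simp add: P_def)
  have mono: "h x < h y" if "0 \<le> x" "x < y" for x y
    unfolding h_def using that N
    by (intro add_le_less_mono sum_mono mult_left_mono power_mono power_strict_mono) auto
  have "h 0 = 0" using N by (simp add: h_def power_0_left)
  have "h 1 \<ge> 2"
  proof -
    have "real (L ! 0) \<le> (\<Sum>k<N. real (L ! k))" using N by (intro member_le_sum) auto
    then show ?thesis using L0 by (simp add: h_def)
  qed
  have "continuous_on {0..1} h" unfolding h_def by (intro continuous_intros)
  then obtain v where v: "0 \<le> v" "v \<le> 1" "h v = 1"
    using IVT'[of h 0 1 1] \<open>h 0 = 0\<close> \<open>h 1 \<ge> 2\<close> by auto
  have v01: "0 < v" "v < 1" using v \<open>h 0 = 0\<close> \<open>h 1 \<ge> 2\<close> by (cases "v = 0"; cases "v = 1"; force)+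
  have "zeck_root L = 1 / v"
    unfolding root
  proof (rule the_equality)
    show "P (1 / v)" using v v01 by (simp add: P_iff)
    fix x assume "P x"
    then have x: "0 < x" "h (1 / x) = 1" by (auto simp: P_iff)
    have "1 / x = v" using mono[of "1 / x" v] mono[of v "1 / x"] x v v01
      by (cases "1 / x" v rule: linorder_cases) auto
    then show "x = 1 / v" by auto
  qed
  then show "1 < zeck_root L"
    and "(\<Sum>k<length L. real (L ! k) * (1 / zeck_root L) ^ Suc k) + (1 / zeck_root L) ^ length L = 1"
    using v v01 by (simp_all add: h_def N_def)
qed

lemma zeck_Q_eq: "zeck_Q L = (\<lambda>n. (1 / zeck_root L) ^ n)"
  by (rule ext) (simp add: zeck_Q_def)

text \<open>By the equation for the zero, period number \<open>q\<close> of
  \<open>beta_star L\<close> is worth \<open>u ^ (q * N) * (1 - u ^ N)\<close>, so sums over full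
  periods telescope to \<open>1 - u ^ (q * N)\<close>. Each period begins with a positive
  digit.\<close>

lemma greedy_base_zeck:
  assumes L: "zeck_list L"
  shows "greedy_base (beta_star L) (1 / zeck_root L)"
proof
  define u where "u = 1 / zeck_root L"
  define N where "N = length L"
  have N: "2 \<le> N" and L0: "0 < L ! 0" using L by (auto simp: N_def zeck_list_def)
  show u: "0 < 1 / zeck_root L" "1 / zeck_root L < 1" using zeck_root_props(1)[OF L] by auto
  then have u': "0 < u" "u < 1" by (auto simp: u_def)
  show "\<exists>j\<ge>k. 0 < beta_star L (Suc j)" for k
    using L0 N by (intro exI[of _ "k * N"]) (auto simp: beta_star_Suc N_def)
  define f where "f k = real (beta_star L (Suc k)) * u ^ Suc k" for k
  have period: "sum f {q * N..<q * N + N} = u ^ (q * N) * (1 - u ^ N)" for q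
  proof -
    have "sum f {q * N..<q * N + N} = (\<Sum>k<N. f (k + q * N))"
      using sum.shift_bounds_nat_ivl[of f 0 "q * N" N] by (simp add: add.commute lessThan_atLeast0)
    also have "\<dots> = (\<Sum>k<N. u ^ (q * N) * (real (L ! k) * u ^ Suc k))"
      by (intro sum.cong) (auto simp: f_def beta_star_Suc N_def[symmetric] power_add algebra_simps)
    also have "\<dots> = u ^ (q * N) * (1 - u ^ N)"
    proof -
      have "(\<Sum>k<N. real (L ! k) * u ^ Suc k) = 1 - u ^ N"
        using zeck_root_props(2)[OF L] unfolding u_def N_def by linarith
      then show ?thesis by (simp only: sum_distrib_left[symmetric])
    qed
    finally show ?thesis .
  qed
  have part: "sum f {..<q * N} = 1 - u ^ (q * N)" for q
  proof (induction q)
    case (Suc q)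
    have "sum f {..<Suc q * N} = sum f {..<q * N} + sum f {q * N..<q * N + N}"
      using sum.atLeastLessThan_concat[of 0 "q * N" "q * N + N" f]
      by (simp add: lessThan_atLeast0 add.commute)
    then show ?case unfolding Suc.IH period by (simp add: algebra_simps power_add)
  qed simp
  have f0: "0 \<le> f k" for k using u' by (simp add: f_def)
  have "sum f {..<n} \<le> 1" for n
  proof -
    have "sum f {..<n} \<le> sum f {..<n * N}" using N f0 by (intro sum_mono2) auto
    also have "\<dots> \<le> 1" using u' by (simp add: part)
    finally show ?thesis .
  qed
  then have "summable f" by (intro summableI_nonneg_bounded f0)
  then have "(\<lambda>n. sum f {..<n}) \<longlonglongrightarrow> suminf f" by (rule summable_LIMSEQ)
  \<comment> \<open>The limit of all partial sums is identified along the multiples of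
    \<open>N\<close>.\<close>
  moreover have sm: "strict_mono (\<lambda>q. q * N)" using N by (auto simp: strict_mono_def)
  ultimately have "(\<lambda>q. sum f {..<q * N}) \<longlonglongrightarrow> suminf f"
    using LIMSEQ_subseq_LIMSEQ[of "\<lambda>n. sum f {..<n}" "suminf f" "\<lambda>q. q * N"] by (simp add: o_def)
  moreover have "(\<lambda>q. sum f {..<q * N}) \<longlonglongrightarrow> 1 - 0"
    unfolding part using LIMSEQ_subseq_LIMSEQ[OF LIMSEQ_realpow_zero[of u] sm] u'
    by (intro tendsto_diff tendsto_const) (simp add: o_def)
  ultimately have "suminf f = 1" using LIMSEQ_unique by fastforce
  then show "(\<lambda>k. real (beta_star L (Suc k)) * (1 / zeck_root L) ^ Suc k) sums 1"
    using summable_sums[OF \<open>summable f\<close>] by (simp add: f_def[abs_def] u_def)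
qed

section \<open>Difference quotients\<close>

text \<open>The word \<open>beta_star L\<close> is admissible for \<open>Lt\<close>. If the zero for
  \<open>Lt\<close> were not larger, this word would have value at least 1 in the base of
  \<open>Lt\<close>, hence could never reset and would equal \<open>beta_star Lt\<close>; then the
  two collections would coincide.\<close>

lemma zeck_root_strict_mono:
  assumes L: "zeck_list L" and Lt: "zeck_list Lt" and sub: "zeck_coll L \<subset> zeck_coll Lt"
  shows "zeck_root L < zeck_root Lt"
proof (rule ccontr)
  assume "\<not> zeck_root L < zeck_root Lt"
  then have le: "zeck_root Lt \<le> zeck_root L" by simp
  interpret l: greedy_base "beta_star L" "1 / zeck_root L" by (rule greedy_base_zeck[OF L])
  interpret t: greedy_base "beta_star Lt" "1 / zeck_root Lt" by (rule greedy_base_zeck[OF Lt])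
  have "match_len (beta_star L) (beta_star L) k = k" for k by (induction k) auto
  then have "admissible (beta_star L) n (beta_star L)" for n by (simp add: admissible_def)
  then have adm: "admissible (beta_star Lt) n (beta_star L)" for n
    using admissible_subset[OF Lt] sub by blast
  have "1 / zeck_root L \<le> 1 / zeck_root Lt"
    using le t.u(1) by (intro divide_left_mono) auto
  then have "(\<Sum>k. real (beta_star L (Suc k)) * (1 / zeck_root L) ^ Suc k) \<le>
      (\<Sum>k. real (beta_star L (Suc k)) * (1 / zeck_root Lt) ^ Suc k)"
    using l.u(1) l.sums_1 t.summable_digits[OF adm]
    by (intro suminf_le mult_left_mono power_mono) (auto simp: sums_iff)
  then have ge: "1 \<le> coeff_sum (beta_star L) (\<lambda>n. (1 / zeck_root Lt) ^ n)"
    using l.sums_1 by (simp add: coeff_sum_def sums_iff)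
  \<comment> \<open>A reset would push the value strictly below 1.\<close>
  have nz: "match_len (beta_star Lt) (beta_star L) q \<noteq> 0" if "0 < q" for q
    using t.coeff_sum_less_1[OF adm that] ge by fastforce
  have run: "match_len (beta_star Lt) (beta_star L) k = k" for k
    using match_len_run[of 0 k "beta_star Lt" "beta_star L"] nz by simp
  have "beta_star L j = beta_star Lt j" for j
  proof (cases j)
    case 0
    then show ?thesis by (simp add: beta_star_def)
  next
    case (Suc k)
    then show ?thesis using nz[of "Suc k"] run[of k] by (simp split: if_splits)
  qed
  then have "zeck_coll L = zeck_coll Lt" by (intro zeck_coll_cong ext)
  then show False using sub by simp
qed

section \<open>The function \<open>delta_star\<close> at values of admissible words\<close>

lemma zeck_star_coll_coeff_sum:
  assumes L: "zeck_list L" and w: "w \<in> zeck_star_coll L"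
  shows "0 < coeff_sum w (zeck_Q L)" "coeff_sum w (zeck_Q L) < 1"
proof -
  interpret greedy_base "beta_star L" "1 / zeck_root L" by (rule greedy_base_zeck[OF L])
  have w': "w \<noteq> (\<lambda>_. 0)" "w 0 = 0" "\<And>n. admissible (beta_star L) n w"
    "\<And>k. \<exists>q\<ge>k. match_len (beta_star L) w q = 0"
    using w zeck_star_coll_iff[OF L] by auto
  from w'(1) obtain m where m: "w m \<noteq> 0" by auto
  then have "1 \<le> m" using w'(2) by (cases m) auto
  have "0 < real (w m) * (1 / zeck_root L) ^ m" using m u by simp
  also have "\<dots> \<le> coeff_sum w (zeck_Q L)"
    unfolding zeck_Q_eq by (rule digit_le_coeff_sum[OF w'(3) \<open>1 \<le> m\<close>])
  finally show "0 < coeff_sum w (zeck_Q L)" .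
  obtain q where "1 \<le> q" "match_len (beta_star L) w q = 0" using w'(4) by blast
  then show "coeff_sum w (zeck_Q L) < 1"
    unfolding zeck_Q_eq using coeff_sum_less_1[OF w'(3), of q] by simp
qed

lemma coeff_sum_shift:
  fixes u :: real
  assumes "summable (\<lambda>k. real (w (Suc k)) * u ^ Suc k)" "\<And>j. 1 \<le> j \<Longrightarrow> j \<le> d \<Longrightarrow> w j = 0"
  shows "coeff_sum w (\<lambda>n. u ^ n) = u ^ d * coeff_sum (\<lambda>j. w (j + d)) (\<lambda>n. u ^ n)"
proof (cases "u = 0")
  case True
  have "w 1 = 0" if "0 < d" using assms(2)[of 1] that by simp
  with True show ?thesis
    by (cases "d = 0") (simp_all add: coeff_sum_def power_0_left)
next
  case False
  have *: "(\<lambda>k. real (w (Suc (k + d))) * u ^ Suc (k + d)) = (\<lambda>k. u ^ d * (real (w (Suc k + d)) * u ^ Suc k))"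
    by (simp add: fun_eq_iff power_add)
  have "summable (\<lambda>k. u ^ d * (real (w (Suc k + d)) * u ^ Suc k))"
    using summable_ignore_initial_segment[OF assms(1), of d] unfolding * .
  then have s: "summable (\<lambda>k. real (w (Suc k + d)) * u ^ Suc k)"
    using False by (subst (asm) summable_cmult_iff) simp
  have "coeff_sum w (\<lambda>n. u ^ n) = (\<Sum>k. real (w (Suc (k + d))) * u ^ Suc (k + d)) +
      (\<Sum>k<d. real (w (Suc k)) * u ^ Suc k)"
    unfolding coeff_sum_def by (rule suminf_split_initial_segment[OF assms(1)])
  also have "(\<Sum>k<d. real (w (Suc k)) * u ^ Suc k) = 0"
    using assms(2) by (intro sum.neutral) auto
  also have "(\<Sum>k. real (w (Suc (k + d))) * u ^ Suc (k + d)) = u ^ d * (\<Sum>k. real (w (Suc k + d)) * u ^ Suc k)"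
    unfolding * by (rule suminf_mult[OF s])
  finally show ?thesis by (simp add: coeff_sum_def)
qed

lemma zeck_star_coll_shift:
  assumes L: "zeck_list L" and w: "w \<in> zeck_star_coll L" and d: "\<And>j. j \<le> d \<Longrightarrow> w j = 0"
  shows "(\<lambda>j. w (j + d)) \<in> zeck_star_coll L"
proof -
  let ?w = "\<lambda>j. w (j + d)"
  have w': "w \<noteq> (\<lambda>_. 0)" "w 0 = 0" "\<And>n. admissible (beta_star L) n w"
    "\<And>k. \<exists>q\<ge>k. match_len (beta_star L) w q = 0"
    using w zeck_star_coll_iff[OF L] by auto
  note pos = beta_star_1_pos[OF L]
  have adm: "admissible (beta_star L) n ?w" for n
    by (rule admissible_shift) (use d pos w'(3) in auto)
  have state: "\<exists>q\<ge>k. match_len (beta_star L) ?w q = 0" for k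
  proof -
    obtain q where q: "k + d \<le> q" "match_len (beta_star L) w q = 0" using w'(4) by blast
    have "match_len (beta_star L) w (q - d + d) = match_len (beta_star L) ?w (q - d)"
      by (rule match_len_shift) (use d pos in auto)
    then show ?thesis using q by (intro exI[of _ "q - d"]) auto
  qed
  from w'(1) obtain m where m: "w m \<noteq> 0" by auto
  then have "d < m" using d not_less by blast
  then have "?w (m - d) \<noteq> 0" using m by simp
  then have "?w \<noteq> (\<lambda>_. 0)" by metis
  then show ?thesis using zeck_star_coll_iff[OF L] adm state d by simp
qed

text \<open>Injectivity of the value recovers \<open>w\<close> from its value for \<open>Lt\<close>,
  and \<open>rev_bar\<close> fixes \<open>w\<close>.\<close>

lemma delta1_star_eq:
  assumes L: "zeck_list L" and Lt: "zeck_list Lt"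
    and w: "w \<in> zeck_star_coll Lt" "\<And>n. admissible (beta_star L) n w"
  shows "delta1_star L Lt (coeff_sum w (zeck_Q Lt)) = coeff_sum w (zeck_Q L) /
    coeff_sum w (zeck_Q Lt) powr log (zeck_root Lt) (zeck_root L)"
proof -
  interpret greedy_base "beta_star Lt" "1 / zeck_root Lt" by (rule greedy_base_zeck[OF Lt])
  note iff = zeck_star_coll_iff[OF Lt]
  have "(THE \<epsilon>. \<epsilon> \<in> zeck_star_coll Lt \<and> coeff_sum \<epsilon> (zeck_Q Lt) = coeff_sum w (zeck_Q Lt)) = w"
  proof (rule the_equality)
    fix w' assume "w' \<in> zeck_star_coll Lt \<and> coeff_sum w' (zeck_Q Lt) = coeff_sum w (zeck_Q Lt)"
    then show "w' = w" using w(1) unfolding iff zeck_Q_eq by (intro coeff_sum_inj) auto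
  qed (use w in auto)
  moreover have "rev_bar L w = w" using w unfolding iff by (intro rev_bar_id[OF L]) auto
  ultimately show ?thesis by (simp add: delta1_star_def Let_def)
qed

text \<open>If \<open>Suc d\<close> is the first nonzero position, dividing the value by
  \<open>v ^ d\<close> shifts \<open>w\<close> so that it starts with a nonzero digit. Since
  \<open>v powr \<gamma> = u\<close>, numerator and denominator both scale by
  \<open>u ^ d\<close>.\<close>

lemma delta_star_eq:
  assumes L: "zeck_list L" and Lt: "zeck_list Lt"
    and w: "w \<in> zeck_star_coll Lt" "\<And>n. admissible (beta_star L) n w"
  shows "delta_star L Lt (coeff_sum w (zeck_Q Lt)) = coeff_sum w (zeck_Q L) /
    coeff_sum w (zeck_Q Lt) powr log (zeck_root Lt) (zeck_root L)"
proof -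
  interpret l: greedy_base "beta_star L" "1 / zeck_root L" by (rule greedy_base_zeck[OF L])
  interpret t: greedy_base "beta_star Lt" "1 / zeck_root Lt" by (rule greedy_base_zeck[OF Lt])
  define u where "u = 1 / zeck_root L"
  define v where "v = 1 / zeck_root Lt"
  define \<gamma> where "\<gamma> = log (zeck_root Lt) (zeck_root L)"
  have v: "0 < v" "v < 1" using t.u by (auto simp: v_def)
  have u: "0 < u" using l.u by (auto simp: u_def)
  have Q: "zeck_Q L n = u ^ n" "zeck_Q Lt n = v ^ n" for n by (simp_all add: zeck_Q_def u_def v_def)
  have Qf: "zeck_Q L = (\<lambda>n. u ^ n)" "zeck_Q Lt = (\<lambda>n. v ^ n)" by (simp_all add: zeck_Q_eq u_def v_def)
  have roots: "1 < zeck_root L" "1 < zeck_root Lt" using zeck_root_props(1) L Lt by auto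
  have v\<gamma>: "v powr \<gamma> = u"
  proof -
    have "v powr \<gamma> = inverse (zeck_root Lt powr \<gamma>)"
      using roots by (simp add: v_def powr_divide inverse_eq_divide)
    also have "zeck_root Lt powr \<gamma> = zeck_root L" using roots by (simp add: \<gamma>_def)
    finally show ?thesis by (simp add: u_def inverse_eq_divide)
  qed
  have wt: "w \<noteq> (\<lambda>_. 0)" "w 0 = 0" "\<And>n. admissible (beta_star Lt) n w"
    using w zeck_star_coll_iff[OF Lt] by auto
  define m where "m = (LEAST j. w j \<noteq> 0)"
  have m: "w m \<noteq> 0" unfolding m_def by (rule LeastI_ex) (use wt(1) in auto)
  have below: "w j = 0" if "j < m" for j using not_less_Least that unfolding m_def by blast
  obtain d where d: "m = Suc d" using m wt(2) by (cases m) auto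
  have d0: "w j = 0" if "j \<le> d" for j using below that d by simp
  let ?w = "\<lambda>j. w (j + d)"
  have w': "?w \<in> zeck_star_coll Lt" by (rule zeck_star_coll_shift[OF Lt w(1) d0])
  have w'L: "admissible (beta_star L) n ?w" for n
    by (rule admissible_shift) (use d0 beta_star_1_pos[OF L] w(2) in auto)
  define y where "y = coeff_sum w (zeck_Q Lt)"
  define y' where "y' = coeff_sum ?w (zeck_Q Lt)"
  have yy': "y = v ^ d * y'"
    unfolding y_def y'_def Qf v_def
    by (rule coeff_sum_shift[OF t.summable_digits[OF wt(3)]]) (use d0 in auto)
  have xx': "coeff_sum w (zeck_Q L) = u ^ d * coeff_sum ?w (zeck_Q L)"
    unfolding Qf u_def
    by (rule coeff_sum_shift[OF l.summable_digits[OF w(2)]]) (use d0 in auto)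
  have y'1: "0 < y'" "y' < 1" using zeck_star_coll_coeff_sum[OF Lt w'] by (auto simp: y'_def)
  have y'v: "v \<le> y'"
  proof -
    have "1 * v \<le> real (?w 1) * v" using m d v by (intro mult_right_mono) auto
    also have "\<dots> \<le> y'"
      using t.digit_le_coeff_sum[of ?w 1] w' zeck_star_coll_iff[OF Lt]
      unfolding y'_def zeck_Q_eq v_def by simp
    finally show ?thesis by simp
  qed
  \<comment> \<open>From \<open>v \<le> y' < 1\<close>, any candidate \<open>n\<close> satisfies
    \<open>d < n\<close> and \<open>n - 1 < Suc d\<close>.\<close>
  have "(THE n. 1 \<le> n \<and> zeck_Q Lt n \<le> y \<and> y < zeck_Q Lt (n - 1)) = Suc d"
  proof (rule the_equality)
    show "1 \<le> Suc d \<and> zeck_Q Lt (Suc d) \<le> y \<and> y < zeck_Q Lt (Suc d - 1)"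
      using y'1 y'v v unfolding yy' Q by simp
    fix n assume n: "1 \<le> n \<and> zeck_Q Lt n \<le> y \<and> y < zeck_Q Lt (n - 1)"
    have "v ^ n < v ^ d"
      using n y'1 v unfolding yy' Q by (smt (verit) mult_less_cancel_left2 zero_less_power)
    moreover have "v ^ Suc d < v ^ (n - 1)"
      using n y'v v unfolding yy' Q by (smt (verit) mult.commute mult_left_mono power_Suc zero_less_power)
    ultimately show "n = Suc d" using v n by (simp add: power_strict_decreasing_iff del: power_Suc)
  qed
  then have "delta_star L Lt y = delta1_star L Lt (y / v ^ d)"
    by (simp add: delta_star_def Let_def Q)
  also have "y / v ^ d = coeff_sum ?w (zeck_Q Lt)" using v by (simp add: yy' y'_def)
  also have "delta1_star L Lt \<dots> = coeff_sum ?w (zeck_Q L) / y' powr \<gamma>"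
    unfolding delta1_star_eq[OF L Lt w' w'L] y'_def \<gamma>_def ..
  also have "\<dots> = coeff_sum w (zeck_Q L) / y powr \<gamma>"
  proof -
    have "(v ^ d) powr \<gamma> = u ^ d"
      using v v\<gamma> by (simp add: powr_realpow[symmetric] powr_powr powr_power mult.commute)
        (metis powr_powr powr_realpow u)
    then have "y powr \<gamma> = u ^ d * y' powr \<gamma>"
      using v y'1 by (simp add: yy' powr_mult)
    then show ?thesis using u by (simp add: xx')
  qed
  finally show ?thesis by (simp add: y_def \<gamma>_def)
qed

section \<open>A criterion for non-differentiability\<close>

lemma not_differentiable_if_exp_quotients:
  fixes f :: "real \<Rightarrow> real"
  assumes Y: "Y \<longlonglongrightarrow> y" "\<forall>\<^sub>F n in sequentially. Y n \<noteq> y"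
    and r: "1 < r" "\<forall>\<^sub>F n in sequentially. r ^ n \<le> (f (Y n) - f y) / (Y n - y)"
  shows "\<not> f differentiable (at y)"
proof
  assume "f differentiable (at y)"
  then obtain D where "(f has_real_derivative D) (at y)" by (auto simp: real_differentiable_def)
  then have "((\<lambda>x. (f x - f y) / (x - y)) \<longlongrightarrow> D) (at y)"
    by (simp add: has_field_derivative_iff)
  moreover have "filterlim Y (at y) sequentially"
    using Y by (auto intro: filterlim_atI)
  ultimately have "(\<lambda>n. (f (Y n) - f y) / (Y n - y)) \<longlonglongrightarrow> D"
    by (rule filterlim_compose)
  \<comment> \<open>Convergent quotients eventually stay below \<open>D + 1\<close>, whereas the
    powers of \<open>r > 1\<close> do not.\<close>
  then have "\<forall>\<^sub>F n in sequentially. (f (Y n) - f y) / (Y n - y) < D + 1"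
    by (rule order_tendstoD) simp
  with r(2) have "\<forall>\<^sub>F n in sequentially. r ^ n < D + 1"
    by eventually_elim simp
  then obtain N where N: "\<And>n. N \<le> n \<Longrightarrow> r ^ n < D + 1" by (auto simp: eventually_sequentially)
  obtain k where k: "D + 1 < r ^ k" using real_arch_pow[OF r(1)] by blast
  have "r ^ k \<le> r ^ (k + N)" using r(1) by (intro power_increasing) auto
  then show False using N[of "k + N"] k by simp
qed

lemma admissible_zero_tail_in_star_coll:
  assumes L: "zeck_list L" and w: "admissible (beta_star L) n w" "\<And>j. n < j \<Longrightarrow> w j = 0"
    and nz: "w 0 = 0" "w m \<noteq> 0"
  shows "w \<in> zeck_star_coll L"
proof -
  interpret greedy_base "beta_star L" "1 / zeck_root L" by (rule greedy_base_zeck[OF L])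
  have "w \<noteq> (\<lambda>_. 0)" using nz by metis
  then show ?thesis
    using zeck_star_coll_iff[OF L] nz admissible_zero_tail[OF w] zero_tail_state[of n w] w(2) by blast
qed

text \<open>The factor \<open>y powr \<gamma>\<close> is differentiable at a positive point, so the
  product \<open>?G\<close> would inherit differentiability. By \<open>delta_star_eq\<close>, its
  values at the points considered are the values of the words for \<open>L\<close>.\<close>

lemma delta_star_not_differentiable:
  assumes L: "zeck_list L" and Lt: "zeck_list Lt" and less: "zeck_root L < zeck_root Lt"
    and w: "w \<in> zeck_star_coll Lt" "\<And>n. admissible (beta_star L) n w"
    and W: "\<And>n. n0 \<le> n \<Longrightarrow> W n \<in> zeck_star_coll Lt" "\<And>n m. n0 \<le> n \<Longrightarrow> admissible (beta_star L) m (W n)"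
    and lim: "(\<lambda>n. coeff_sum (W n) (zeck_Q Lt)) \<longlonglongrightarrow> coeff_sum w (zeck_Q Lt)"
    and ne: "\<And>n. n0 \<le> n \<Longrightarrow> coeff_sum (W n) (zeck_Q Lt) \<noteq> coeff_sum w (zeck_Q Lt)"
    and quot: "\<And>n. n0 \<le> n \<Longrightarrow> (zeck_root Lt / zeck_root L) ^ n \<le>
      (coeff_sum (W n) (zeck_Q L) - coeff_sum w (zeck_Q L)) /
      (coeff_sum (W n) (zeck_Q Lt) - coeff_sum w (zeck_Q Lt))"
  shows "\<not> delta_star L Lt differentiable (at (coeff_sum w (zeck_Q Lt)))"
proof
  let ?\<gamma> = "log (zeck_root Lt) (zeck_root L)"
  let ?y = "coeff_sum w (zeck_Q Lt)"
  let ?G = "\<lambda>y. delta_star L Lt y * y powr ?\<gamma>"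
  assume diff: "delta_star L Lt differentiable (at ?y)"
  have G: "?G (coeff_sum x (zeck_Q Lt)) = coeff_sum x (zeck_Q L)"
    if "x \<in> zeck_star_coll Lt" "\<And>n. admissible (beta_star L) n x" for x
    using delta_star_eq[OF L Lt that] zeck_star_coll_coeff_sum(1)[OF Lt that(1)] by simp
  have "0 < ?y" by (rule zeck_star_coll_coeff_sum[OF Lt w(1)])
  then have "(\<lambda>y. y powr ?\<gamma>) differentiable (at ?y)"
    by (auto simp: real_differentiable_def intro!: exI derivative_eq_intros)
  with diff have "?G differentiable (at ?y)" by (rule differentiable_mult)
  moreover have "\<not> ?G differentiable (at ?y)"
  proof (rule not_differentiable_if_exp_quotients[OF lim])
    show "1 < zeck_root Lt / zeck_root L" using less zeck_root_props(1)[OF L] by simp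
    show "\<forall>\<^sub>F n in sequentially. coeff_sum (W n) (zeck_Q Lt) \<noteq> ?y"
      using eventually_ge_at_top[of n0] by eventually_elim (rule ne)
    show "\<forall>\<^sub>F n in sequentially. (zeck_root Lt / zeck_root L) ^ n \<le>
       (?G (coeff_sum (W n) (zeck_Q Lt)) - ?G ?y) / (coeff_sum (W n) (zeck_Q Lt) - ?y)"
      using eventually_ge_at_top[of n0]
    proof eventually_elim
      case (elim n)
      show ?case unfolding G[OF W[OF elim]] G[OF w] by (rule quot[OF elim])
    qed
  qed
  ultimately show False by blast
qed

section \<open>Values of the approximating words\<close>

lemma coeff_sum_truncate:
  fixes u :: real
  shows "coeff_sum (\<lambda>k. if k \<le> n then w k else 0) (\<lambda>n. u ^ n) = (\<Sum>k<n. real (w (Suc k)) * u ^ Suc k)"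
proof -
  have "coeff_sum (\<lambda>k. if k \<le> n then w k else 0) (\<lambda>n. u ^ n) =
      (\<Sum>k\<in>{..<n}. real (if Suc k \<le> n then w (Suc k) else 0) * u ^ Suc k)"
    unfolding coeff_sum_def by (rule suminf_finite) auto
  also have "\<dots> = (\<Sum>k<n. real (w (Suc k)) * u ^ Suc k)" by (intro sum.cong) auto
  finally show ?thesis .
qed

lemma coeff_sum_set_digit:
  fixes u :: real
  assumes "summable (\<lambda>k. real (w (Suc k)) * u ^ Suc k)" "1 \<le> n" "w n = 0"
  shows "coeff_sum (w(n := 1)) (\<lambda>n. u ^ n) = coeff_sum w (\<lambda>n. u ^ n) + u ^ n"
proof -
  obtain i where i: "n = Suc i" using assms(2) by (cases n) auto
  have "(\<lambda>k. real (w (Suc k)) * u ^ Suc k + (if k = i then u ^ Suc k else 0)) sums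
      (coeff_sum w (\<lambda>n. u ^ n) + u ^ Suc i)"
    unfolding coeff_sum_def by (intro sums_add summable_sums assms(1) sums_single)
  moreover have "(\<lambda>k. real (w (Suc k)) * u ^ Suc k + (if k = i then u ^ Suc k else 0)) =
      (\<lambda>k. real ((w(n := 1)) (Suc k)) * u ^ Suc k)"
    using assms(3) by (auto simp: i)
  ultimately show ?thesis unfolding coeff_sum_def using i by (simp add: sums_iff)
qed

theorem theorem4p5:
  fixes L Lt :: "nat list" and \<epsilon> :: coeff_fun
  assumes "zeck_list L" and "zeck_list Lt"
    and "zeck_coll L \<subset> zeck_coll Lt"
    and "\<epsilon> \<in> zeck_star_closure L Lt"
  shows "coeff_sum \<epsilon> (zeck_Q Lt) \<in> {0<..<1} \<and>
    \<not> delta_star L Lt differentiable (at (coeff_sum \<epsilon> (zeck_Q Lt)))"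
proof
  note L = assms(1) and Lt = assms(2)
  interpret l: greedy_base "beta_star L" "1 / zeck_root L" by (rule greedy_base_zeck[OF L])
  interpret t: greedy_base "beta_star Lt" "1 / zeck_root Lt" by (rule greedy_base_zeck[OF Lt])
  define u where "u = 1 / zeck_root L"
  define v where "v = 1 / zeck_root Lt"
  define r where "r = zeck_root Lt / zeck_root L"
  have Q: "zeck_Q L = (\<lambda>n. u ^ n)" "zeck_Q Lt = (\<lambda>n. v ^ n)" by (simp_all add: zeck_Q_eq u_def v_def)
  have less: "zeck_root L < zeck_root Lt" by (rule zeck_root_strict_mono[OF assms(1-3)])
  have v: "0 < v" "v < 1" using t.u by (auto simp: v_def)
  have r: "1 < r" using less zeck_root_props(1)[OF L] by (simp add: r_def)
  \<comment> \<open>Passing from the values for \<open>Lt\<close> to those for \<open>L\<close> thus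
    weights position \<open>k\<close> by \<open>r ^ k\<close>.\<close>
  have u: "u = r * v" using zeck_root_props(1)[OF Lt] by (simp add: u_def v_def r_def)
  have \<epsilon>: "\<epsilon> \<in> zeck_star_coll Lt" using assms(4) by (simp add: zeck_star_closure_def)
  have admL: "admissible (beta_star L) n \<epsilon>" for n
    by (rule zeck_star_closure_admissible[OF L assms(4)])
  have \<epsilon>': "\<epsilon> \<noteq> (\<lambda>_. 0)" "\<epsilon> 0 = 0" "\<And>n. admissible (beta_star Lt) n \<epsilon>"
    using \<epsilon> zeck_star_coll_iff[OF Lt] by auto
  have sumL: "summable (\<lambda>k. real (\<epsilon> (Suc k)) * u ^ Suc k)"
    unfolding u_def by (rule l.summable_digits[OF admL])
  have sumt: "summable (\<lambda>k. real (\<epsilon> (Suc k)) * v ^ Suc k)"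
    unfolding v_def by (rule t.summable_digits[OF \<epsilon>'(3)])
  from \<epsilon>'(1) obtain m where m: "\<epsilon> m \<noteq> 0" by auto
  show "coeff_sum \<epsilon> (zeck_Q Lt) \<in> {0<..<1}"
    using zeck_star_coll_coeff_sum[OF Lt \<epsilon>] by simp
  show "\<not> delta_star L Lt differentiable (at (coeff_sum \<epsilon> (zeck_Q Lt)))"
  proof (cases "\<exists>K. \<forall>j>K. \<epsilon> j = 0")
    case False
    define W where "W n = (\<lambda>k. if k \<le> n then \<epsilon> k else 0)" for n
    have Wadm: "admissible (beta_star L) n (W n)" "admissible (beta_star Lt) n (W n)" for n
      using admL[of n] \<epsilon>'(3)[of n] admissible_cong[of n "W n" \<epsilon>] by (auto simp: W_def)
    have WL: "admissible (beta_star L) k (W n)" for n k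
      using Wadm(1) by (rule admissible_zero_tail) (simp add: W_def)
    \<comment> \<open>For \<open>m \<le> n\<close> the nonzero digit \<open>\<epsilon> m\<close>
      survives the truncation.\<close>
    have Wt: "W n \<in> zeck_star_coll Lt" if "m \<le> n" for n
      by (rule admissible_zero_tail_in_star_coll[OF Lt Wadm(2), of n m])
        (use that m \<epsilon>'(2) in \<open>auto simp: W_def\<close>)
    have lim: "(\<lambda>n. coeff_sum (W n) (zeck_Q Lt)) \<longlonglongrightarrow> coeff_sum \<epsilon> (zeck_Q Lt)"
      unfolding W_def Q coeff_sum_truncate unfolding coeff_sum_def by (rule summable_LIMSEQ[OF sumt])
    have diff: "coeff_sum \<epsilon> (\<lambda>n. x ^ n) - coeff_sum (W n) (\<lambda>n. x ^ n) =
        (\<Sum>k. real (\<epsilon> (Suc (k + n))) * x ^ Suc (k + n))"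
      if "summable (\<lambda>k. real (\<epsilon> (Suc k)) * x ^ Suc k)" for x :: real and n
      unfolding W_def coeff_sum_truncate unfolding coeff_sum_def
      using suminf_split_initial_segment[OF that, of n] by simp
    have sumL': "summable (\<lambda>k. real (\<epsilon> (Suc (k + n))) * u ^ Suc (k + n))" for n
      using summable_ignore_initial_segment[OF sumL, of n] .
    have sumt': "summable (\<lambda>k. real (\<epsilon> (Suc (k + n))) * v ^ Suc (k + n))" for n
      using summable_ignore_initial_segment[OF sumt, of n] .
    \<comment> \<open>Infinite support provides a nonzero digit beyond every
      \<open>n\<close>.\<close>
    have pos: "0 < (\<Sum>k. real (\<epsilon> (Suc (k + n))) * v ^ Suc (k + n))" for n
    proof -
      obtain j where j: "Suc n \<le> j" "\<epsilon> j \<noteq> 0" using False by (metis Suc_le_eq)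
      then show ?thesis using v
        by (intro suminf_pos2[OF sumt', of _ "j - Suc n"]) auto
    qed
    \<comment> \<open>All positions in the tail exceed \<open>n\<close>, so their weights are at
      least \<open>r ^ n\<close>.\<close>
    have ge: "r ^ n * (\<Sum>k. real (\<epsilon> (Suc (k + n))) * v ^ Suc (k + n)) \<le>
        (\<Sum>k. real (\<epsilon> (Suc (k + n))) * u ^ Suc (k + n))" for n
    proof -
      have "(\<Sum>k. r ^ n * (real (\<epsilon> (Suc (k + n))) * v ^ Suc (k + n))) \<le>
          (\<Sum>k. real (\<epsilon> (Suc (k + n))) * u ^ Suc (k + n))"
      proof (rule suminf_le)
        fix k
        have "r ^ n \<le> r ^ Suc (k + n)" using r by (intro power_increasing) auto
        then have "r ^ n * (real (\<epsilon> (Suc (k + n))) * v ^ Suc (k + n)) \<le>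
            r ^ Suc (k + n) * (real (\<epsilon> (Suc (k + n))) * v ^ Suc (k + n))"
          using v by (intro mult_right_mono) auto
        also have "\<dots> = real (\<epsilon> (Suc (k + n))) * u ^ Suc (k + n)"
          unfolding u power_mult_distrib by (simp only: mult_ac)
        finally show "r ^ n * (real (\<epsilon> (Suc (k + n))) * v ^ Suc (k + n)) \<le>
            real (\<epsilon> (Suc (k + n))) * u ^ Suc (k + n)" .
      qed (intro summable_mult sumt' sumL')+
      then show ?thesis using suminf_mult[OF sumt'] by simp
    qed
    show ?thesis
    proof (rule delta_star_not_differentiable[OF L Lt less \<epsilon> admL Wt WL lim])
      fix n
      show "coeff_sum (W n) (zeck_Q Lt) \<noteq> coeff_sum \<epsilon> (zeck_Q Lt)"
        using diff[OF sumt, of n] pos[of n] by (simp add: Q)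
      \<comment> \<open>Truncations approach from below, so the quotient is first formed with both
        signs reversed, which makes the denominator positive.\<close>
      have "r ^ n \<le> (coeff_sum \<epsilon> (zeck_Q L) - coeff_sum (W n) (zeck_Q L)) /
          (coeff_sum \<epsilon> (zeck_Q Lt) - coeff_sum (W n) (zeck_Q Lt))"
        unfolding Q diff[OF sumt] diff[OF sumL] using ge[of n] pos[of n] by (simp only: pos_le_divide_eq)
      also have "\<dots> = (coeff_sum (W n) (zeck_Q L) - coeff_sum \<epsilon> (zeck_Q L)) /
          (coeff_sum (W n) (zeck_Q Lt) - coeff_sum \<epsilon> (zeck_Q Lt))"
        by (metis minus_diff_eq minus_divide_divide)
      finally show "(zeck_root Lt / zeck_root L) ^ n \<le>
          (coeff_sum (W n) (zeck_Q L) - coeff_sum \<epsilon> (zeck_Q L)) /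
          (coeff_sum (W n) (zeck_Q Lt) - coeff_sum \<epsilon> (zeck_Q Lt))"
        by (simp only: r_def)
    qed
  next
    case True
    then obtain K where K: "\<And>j. K < j \<Longrightarrow> \<epsilon> j = 0" by blast
    \<comment> \<open>Beyond a reset \<open>q \<ge> K\<close> only zeros follow, and they keep the
      automaton in state 0.\<close>
    obtain q where q: "K \<le> q" "match_len (beta_star L) \<epsilon> q = 0"
      using l.zero_tail_state[of K \<epsilon>] K by blast
    have state: "match_len (beta_star L) \<epsilon> (q + i) = 0" for i
    proof (induction i)
      case (Suc i)
      have "\<epsilon> (Suc (q + i)) = 0" using K q(1) by simp
      then show ?case using Suc beta_star_1_pos[OF L] by simp
    qed (simp add: q)
    \<comment> \<open>In state 0 the digit 1 is allowed because the first digit of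
      \<open>beta_star L\<close> is positive, and the zeros after it are always allowed.\<close>
    define W where "W n = \<epsilon>(n := 1)" for n
    have Wadm: "admissible (beta_star L) n (W n)" if "Suc q \<le> n" for n
      unfolding admissible_def
    proof (intro allI impI)
      fix k assume k: "k < n"
      have eq: "match_len (beta_star L) (W n) k = match_len (beta_star L) \<epsilon> k"
        by (rule match_len_cong) (use k in \<open>auto simp: W_def\<close>)
      show "W n (Suc k) \<le> beta_star L (Suc (match_len (beta_star L) (W n) k))"
      proof (cases "Suc k = n")
        case True
        then have "match_len (beta_star L) \<epsilon> k = 0" using state[of "k - q"] that by simp
        then show ?thesis using True eq beta_star_1_pos[OF L] by (simp add: W_def)
      next
        case False
        then show ?thesis using admL[of n] k eq by (simp add: W_def admissible_def)
      qed
    qed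
    have W0: "W n j = 0" if "Suc q \<le> n" "n < j" for n j using K q(1) that by (simp add: W_def)
    have WL: "admissible (beta_star L) k (W n)" if "Suc q \<le> n" for n k
      by (rule admissible_zero_tail[OF Wadm[OF that]]) (rule W0[OF that])
    have Wt: "W n \<in> zeck_star_coll Lt" if "Suc q \<le> n" for n
    proof (rule admissible_zero_tail_in_star_coll[OF Lt, of n])
      show "admissible (beta_star Lt) n (W n)"
        using admissible_subset[OF Lt _ Wadm[OF that]] assms(3) by blast
      show "W n 0 = 0" "W n n \<noteq> 0" using that \<epsilon>'(2) by (auto simp: W_def)
    qed (rule W0[OF that])
    have valL: "coeff_sum (W n) (zeck_Q L) = coeff_sum \<epsilon> (zeck_Q L) + u ^ n" if "Suc q \<le> n" for n
      unfolding W_def Q by (rule coeff_sum_set_digit[OF sumL]) (use that q(1) K in auto)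
    have valt: "coeff_sum (W n) (zeck_Q Lt) = coeff_sum \<epsilon> (zeck_Q Lt) + v ^ n" if "Suc q \<le> n" for n
      unfolding W_def Q by (rule coeff_sum_set_digit[OF sumt]) (use that q(1) K in auto)
    have "(\<lambda>n. coeff_sum \<epsilon> (zeck_Q Lt) + v ^ n) \<longlonglongrightarrow> coeff_sum \<epsilon> (zeck_Q Lt) + 0"
      using v by (intro tendsto_intros LIMSEQ_realpow_zero) auto
    moreover have "\<forall>\<^sub>F n in sequentially. coeff_sum \<epsilon> (zeck_Q Lt) + v ^ n = coeff_sum (W n) (zeck_Q Lt)"
      using eventually_ge_at_top[of "Suc q"] by eventually_elim (simp add: valt)
    ultimately have lim: "(\<lambda>n. coeff_sum (W n) (zeck_Q Lt)) \<longlonglongrightarrow> coeff_sum \<epsilon> (zeck_Q Lt)"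
      by (simp add: tendsto_cong)
    show ?thesis
    proof (rule delta_star_not_differentiable[OF L Lt less \<epsilon> admL Wt WL lim])
      fix n assume n: "Suc q \<le> n"
      show "coeff_sum (W n) (zeck_Q Lt) \<noteq> coeff_sum \<epsilon> (zeck_Q Lt)"
        using valt[OF n] v by simp
      \<comment> \<open>Here the quotient is exactly \<open>u ^ n / v ^ n = r ^ n\<close>.\<close>
      show "(zeck_root Lt / zeck_root L) ^ n \<le>
          (coeff_sum (W n) (zeck_Q L) - coeff_sum \<epsilon> (zeck_Q L)) /
          (coeff_sum (W n) (zeck_Q Lt) - coeff_sum \<epsilon> (zeck_Q Lt))"
        unfolding valL[OF n] valt[OF n] r_def[symmetric] using v by (simp add: u power_mult_distrib)
    qed
  qed
qed

end
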